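(* Let $\mathbb{C}$ be an exact category. The inclusion (forgetful) functor $U\colon\mathsf{ParOrd}(\mathbb{C})\to\mathsf{PreOrd}(\mathbb{C})$ from internal partial orders to internal preorders in $\mathbb{C}$ has a left adjoint $F\colon\mathsf{PreOrd}(\mathbb{C})\to\mathsf{ParOrd}(\mathbb{C})$. Moreover, $\mathsf{ParOrd}(\mathbb{C})$ is a (regular epi)-reflective subcategory of $\mathsf{PreOrd}(\mathbb{C})$, i.e. every component of the unit of this adjunction is a regular epimorphism in $\mathsf{PreOrd}(\mathbb{C})$.
   Context: Exact means Barr-exact: finitely complete, every morphism factors as a regular epimorphism followed by a monomorphism, regular epimorphisms are pullback-stable, and every internal equivalence relation is a kernel pair. An object $(A,\rho)$ of $\mathsf{PreOrd}(\mathbb{C})$ is an object $A$ with a relation (subobject) $\langle r_1,r_2\rangle\colon \rho\to A\times A$ that is reflexive (it contains the diagonal $\Delta_A=\langle 1_A,1_A\rangle$) and transitive (there is $\tau\colon\rho\times_A\rho\to\rho$ with $r_1\tau=r_1p_1$, $r_2\tau=r_2p_2$, where $\rho\times_A\rho$ is the pullback of $r_2$ and $r_1$ with projections $p_1,p_2$). A morphism $(A,\rho)\to(B,\sigma)$ is a pair $(f\colon A\to B,\ \overline f\colon\rho\to\sigma)$ with $fr_1=s_1\overline f$ and $fr_2=s_2\overline f$, where $\langle s_1,s_2\rangle\colon\sigma\to B\times B$. With $\rho^o=\langle r_2,r_1\rangle$ the opposite relation, $(A,\rho)$ is an internal partial order if $\rho\wedge\rho^o=\Delta_A$; $\mathsf{ParOrd}(\mathbb{C})$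 is the full subcategory of internal partial orders. *)

theory Defs
  imports Main
begin

section \<open>Categories, functors, adjunctions\<close>

text \<open>
  The operations are total HOL functions; only their values on the carriers \<open>Obj\<close> and \<open>Arr\<close>
  (and, for composition, on composable pairs) are constrained.
\<close>

record ('o, 'm) cat =
  Obj :: "'o set"
  Arr :: "'m set"
  Dom :: "'m \<Rightarrow> 'o"
  Cod :: "'m \<Rightarrow> 'o"
  Ide :: "'o \<Rightarrow> 'm"
  Comp :: "'m \<Rightarrow> 'm \<Rightarrow> 'm" (infixr "\<cdot>\<index>" 75)

definition hom :: "('o, 'm) cat \<Rightarrow> 'o \<Rightarrow> 'o \<Rightarrow> 'm set" where
  "hom C A B = {f \<in> Arr C. Dom C f = A \<and> Cod C f = B}"

locale category =
  fixes C :: "('o, 'm) cat" (structure)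
  assumes Dom_closed: "f \<in> Arr C \<Longrightarrow> Dom C f \<in> Obj C"
    and Cod_closed: "f \<in> Arr C \<Longrightarrow> Cod C f \<in> Obj C"
    and Ide_closed: "A \<in> Obj C \<Longrightarrow> Ide C A \<in> hom C A A"
    and Comp_closed: "f \<in> hom C A B \<Longrightarrow> g \<in> hom C B D \<Longrightarrow> g \<cdot> f \<in> hom C A D"
    and Comp_Ide: "f \<in> hom C A B \<Longrightarrow> f \<cdot> Ide C A = f"
    and Ide_Comp: "f \<in> hom C A B \<Longrightarrow> Ide C B \<cdot> f = f"
    and Comp_assoc:
      "f \<in> hom C A B \<Longrightarrow> g \<in> hom C B D \<Longrightarrow> h \<in> hom C D E \<Longrightarrow> (h \<cdot> g) \<cdot> f = h \<cdot> (g \<cdot> f)"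

definition full_subcat :: "('o, 'm) cat \<Rightarrow> ('o \<Rightarrow> bool) \<Rightarrow> ('o, 'm) cat" where
  "full_subcat C P =
     C\<lparr>Obj := {A \<in> Obj C. P A}, Arr := {f \<in> Arr C. P (Dom C f) \<and> P (Cod C f)}\<rparr>"

record ('o1, 'm1, 'o2, 'm2) cat_functor =
  Omap :: "'o1 \<Rightarrow> 'o2"
  Amap :: "'m1 \<Rightarrow> 'm2"

definition is_functor ::
  "('o1, 'm1) cat \<Rightarrow> ('o2, 'm2) cat \<Rightarrow> ('o1, 'm1, 'o2, 'm2) cat_functor \<Rightarrow> bool" where
  "is_functor C D F \<longleftrightarrow> category C \<and> category D
     \<and> (\<forall>A \<in> Obj C. Omap F A \<in> Obj D)
     \<and> (\<forall>f \<in> Arr C. Amap F f \<in> hom D (Omap F (Dom C f)) (Omap F (Cod C f)))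
     \<and> (\<forall>A \<in> Obj C. Amap F (Ide C A) = Ide D (Omap F A))
     \<and> (\<forall>f \<in> Arr C. \<forall>g \<in> Arr C. Dom C g = Cod C f \<longrightarrow>
          Amap F (g \<cdot>\<^bsub>C\<^esub> f) = Amap F g \<cdot>\<^bsub>D\<^esub> Amap F f)"

definition id_functor :: "('o, 'm, 'o, 'm) cat_functor" where
  "id_functor = \<lparr>Omap = (\<lambda>A. A), Amap = (\<lambda>f. f)\<rparr>"

definition comp_functor ::
  "('o2, 'm2, 'o3, 'm3) cat_functor \<Rightarrow> ('o1, 'm1, 'o2, 'm2) cat_functor
     \<Rightarrow> ('o1, 'm1, 'o3, 'm3) cat_functor" where
  "comp_functor G F = \<lparr>Omap = (\<lambda>A. Omap G (Omap F A)), Amap = (\<lambda>f. Amap G (Amap F f))\<rparr>"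

definition is_nat_trans ::
  "('o1, 'm1) cat \<Rightarrow> ('o2, 'm2) cat \<Rightarrow> ('o1, 'm1, 'o2, 'm2) cat_functor
     \<Rightarrow> ('o1, 'm1, 'o2, 'm2) cat_functor \<Rightarrow> ('o1 \<Rightarrow> 'm2) \<Rightarrow> bool" where
  "is_nat_trans C D F G \<alpha> \<longleftrightarrow> is_functor C D F \<and> is_functor C D G
     \<and> (\<forall>A \<in> Obj C. \<alpha> A \<in> hom D (Omap F A) (Omap G A))
     \<and> (\<forall>f \<in> Arr C. \<alpha> (Cod C f) \<cdot>\<^bsub>D\<^esub> Amap F f = Amap G f \<cdot>\<^bsub>D\<^esub> \<alpha> (Dom C f))"

text \<open>\<open>F : C \<rightarrow> D\<close> is left adjoint to \<open>U : D \<rightarrow> C\<close>, with unit \<open>\<eta>\<close> and counit \<open>\<epsilon>\<close>.\<close>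

definition is_adjunction ::
  "('o1, 'm1) cat \<Rightarrow> ('o2, 'm2) cat \<Rightarrow> ('o1, 'm1, 'o2, 'm2) cat_functor
     \<Rightarrow> ('o2, 'm2, 'o1, 'm1) cat_functor \<Rightarrow> ('o1 \<Rightarrow> 'm1) \<Rightarrow> ('o2 \<Rightarrow> 'm2) \<Rightarrow> bool" where
  "is_adjunction C D F U \<eta> \<epsilon> \<longleftrightarrow> is_functor C D F \<and> is_functor D C U
     \<and> is_nat_trans C C id_functor (comp_functor U F) \<eta>
     \<and> is_nat_trans D D (comp_functor F U) id_functor \<epsilon>
     \<and> (\<forall>A \<in> Obj C. \<epsilon> (Omap F A) \<cdot>\<^bsub>D\<^esub> Amap F (\<eta> A) = Ide D (Omap F A))
     \<and> (\<forall>B \<in> Obj D. Amap U (\<epsilon> B) \<cdot>\<^bsub>C\<^esub> \<eta> (Omap U B) = Ide C (Omap U B))"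


section \<open>Monomorphisms, limits, regular epimorphisms\<close>

definition is_mono :: "('o, 'm) cat \<Rightarrow> 'm \<Rightarrow> bool" where
  "is_mono C m \<longleftrightarrow> m \<in> Arr C
     \<and> (\<forall>X. \<forall>u \<in> hom C X (Dom C m). \<forall>v \<in> hom C X (Dom C m).
          m \<cdot>\<^bsub>C\<^esub> u = m \<cdot>\<^bsub>C\<^esub> v \<longrightarrow> u = v)"

definition is_coequalizer :: "('o, 'm) cat \<Rightarrow> 'm \<Rightarrow> 'm \<Rightarrow> 'm \<Rightarrow> bool" where
  "is_coequalizer C f g e \<longleftrightarrow> f \<in> Arr C \<and> g \<in> hom C (Dom C f) (Cod C f)
     \<and> e \<in> Arr C \<and> Dom C e = Cod C f \<and> e \<cdot>\<^bsub>C\<^esub> f = e \<cdot>\<^bsub>C\<^esub> g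
     \<and> (\<forall>Y. \<forall>h \<in> hom C (Cod C f) Y. h \<cdot>\<^bsub>C\<^esub> f = h \<cdot>\<^bsub>C\<^esub> g \<longrightarrow>
          (\<exists>!k. k \<in> hom C (Cod C e) Y \<and> k \<cdot>\<^bsub>C\<^esub> e = h))"

definition is_regular_epi :: "('o, 'm) cat \<Rightarrow> 'm \<Rightarrow> bool" where
  "is_regular_epi C e \<longleftrightarrow> (\<exists>f g. is_coequalizer C f g e)"

definition is_cone ::
  "('j, 'k) cat \<Rightarrow> ('o, 'm) cat \<Rightarrow> ('j, 'k, 'o, 'm) cat_functor \<Rightarrow> 'o \<Rightarrow> ('j \<Rightarrow> 'm) \<Rightarrow> bool" where
  "is_cone J C D L l \<longleftrightarrow> L \<in> Obj C
     \<and> (\<forall>j \<in> Obj J. l j \<in> hom C L (Omap D j))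
     \<and> (\<forall>a \<in> Arr J. Amap D a \<cdot>\<^bsub>C\<^esub> l (Dom J a) = l (Cod J a))"

definition is_limit ::
  "('j, 'k) cat \<Rightarrow> ('o, 'm) cat \<Rightarrow> ('j, 'k, 'o, 'm) cat_functor \<Rightarrow> 'o \<Rightarrow> ('j \<Rightarrow> 'm) \<Rightarrow> bool" where
  "is_limit J C D L l \<longleftrightarrow> is_cone J C D L l
     \<and> (\<forall>X x. is_cone J C D X x \<longrightarrow>
          (\<exists>!u. u \<in> hom C X L \<and> (\<forall>j \<in> Obj J. l j \<cdot>\<^bsub>C\<^esub> u = x j)))"

text \<open>
  Every finite category is isomorphic to one whose objects and arrows are natural numbers, so
  the index categories below range over all finite shapes. Finiteness of \<open>Arr J\<close> entails that
  of \<open>Obj J\<close>.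
\<close>

definition finitely_complete :: "('o, 'm) cat \<Rightarrow> bool" where
  "finitely_complete C \<longleftrightarrow>
     (\<forall>(J :: (nat, nat) cat) D. finite (Arr J) \<and> is_functor J C D \<longrightarrow> (\<exists>L l. is_limit J C D L l))"

definition is_product :: "('o, 'm) cat \<Rightarrow> 'o \<Rightarrow> 'o \<Rightarrow> 'o \<Rightarrow> 'm \<Rightarrow> 'm \<Rightarrow> bool" where
  "is_product C A B P p q \<longleftrightarrow> p \<in> hom C P A \<and> q \<in> hom C P B
     \<and> (\<forall>X. \<forall>x \<in> hom C X A. \<forall>y \<in> hom C X B.
          \<exists>!u. u \<in> hom C X P \<and> p \<cdot>\<^bsub>C\<^esub> u = x \<and> q \<cdot>\<^bsub>C\<^esub> u = y)"

text \<open>\<open>p\<close> and \<open>q\<close> are the projections of the pullback \<open>P\<close> of \<open>f\<close> and \<open>g\<close>: \<open>f \<cdot> p = g \<cdot> q\<close>.\<close>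

definition is_pullback :: "('o, 'm) cat \<Rightarrow> 'm \<Rightarrow> 'm \<Rightarrow> 'o \<Rightarrow> 'm \<Rightarrow> 'm \<Rightarrow> bool" where
  "is_pullback C f g P p q \<longleftrightarrow> f \<in> Arr C \<and> g \<in> Arr C \<and> Cod C f = Cod C g
     \<and> p \<in> hom C P (Dom C f) \<and> q \<in> hom C P (Dom C g) \<and> f \<cdot>\<^bsub>C\<^esub> p = g \<cdot>\<^bsub>C\<^esub> q
     \<and> (\<forall>X. \<forall>x \<in> hom C X (Dom C f). \<forall>y \<in> hom C X (Dom C g). f \<cdot>\<^bsub>C\<^esub> x = g \<cdot>\<^bsub>C\<^esub> y \<longrightarrow>
          (\<exists>!u. u \<in> hom C X P \<and> p \<cdot>\<^bsub>C\<^esub> u = x \<and> q \<cdot>\<^bsub>C\<^esub> u = y))"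


section \<open>Internal relations\<close>

text \<open>
  A relation \<open>\<langle>r\<^sub>1, r\<^sub>2\<rangle> : R \<rightarrow> A \<times> A\<close> is given by a representative of the subobject and is
  stored through its components: \<open>Base = A\<close>, \<open>Tip = R\<close>, \<open>Leg1 = r\<^sub>1\<close>, \<open>Leg2 = r\<^sub>2\<close>.
  No products or pullbacks are chosen. In a finitely complete category they exist and are unique
  up to isomorphism, so "for some product (pullback)" and "for every product (pullback)" agree.
\<close>

record ('o, 'm) irel =
  Base :: 'o
  Tip :: 'o
  Leg1 :: 'm
  Leg2 :: 'm

definition is_relation :: "('o, 'm) cat \<Rightarrow> ('o, 'm) irel \<Rightarrow> bool" where
  "is_relation C \<rho> \<longleftrightarrow>
     Leg1 \<rho> \<in> hom C (Tip \<rho>) (Base \<rho>) \<and> Leg2 \<rho> \<in> hom C (Tip \<rho>) (Base \<rho>)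
     \<and> (\<exists>P p q m. is_product C (Base \<rho>) (Base \<rho>) P p q \<and> m \<in> hom C (Tip \<rho>) P \<and> is_mono C m
          \<and> p \<cdot>\<^bsub>C\<^esub> m = Leg1 \<rho> \<and> q \<cdot>\<^bsub>C\<^esub> m = Leg2 \<rho>)"

text \<open>The order on subobjects of \<open>A \<times> A\<close>, and equality of subobjects.\<close>

definition rel_le :: "('o, 'm) cat \<Rightarrow> ('o, 'm) irel \<Rightarrow> ('o, 'm) irel \<Rightarrow> bool" where
  "rel_le C \<rho> \<sigma> \<longleftrightarrow> Base \<rho> = Base \<sigma>
     \<and> (\<exists>h \<in> hom C (Tip \<rho>) (Tip \<sigma>). Leg1 \<sigma> \<cdot>\<^bsub>C\<^esub> h = Leg1 \<rho> \<and> Leg2 \<sigma> \<cdot>\<^bsub>C\<^esub> h = Leg2 \<rho>)"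

definition rel_eq :: "('o, 'm) cat \<Rightarrow> ('o, 'm) irel \<Rightarrow> ('o, 'm) irel \<Rightarrow> bool" where
  "rel_eq C \<rho> \<sigma> \<longleftrightarrow> rel_le C \<rho> \<sigma> \<and> rel_le C \<sigma> \<rho>"

definition diag_rel :: "('o, 'm) cat \<Rightarrow> 'o \<Rightarrow> ('o, 'm) irel" where
  "diag_rel C A = \<lparr>Base = A, Tip = A, Leg1 = Ide C A, Leg2 = Ide C A\<rparr>"

definition opp_rel :: "('o, 'm) irel \<Rightarrow> ('o, 'm) irel" where
  "opp_rel \<rho> = \<lparr>Base = Base \<rho>, Tip = Tip \<rho>, Leg1 = Leg2 \<rho>, Leg2 = Leg1 \<rho>\<rparr>"

text \<open>\<open>\<mu>\<close> represents the meet of the subobjects \<open>\<rho>\<close> and \<open>\<sigma>\<close>.\<close>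

definition is_rel_meet ::
  "('o, 'm) cat \<Rightarrow> ('o, 'm) irel \<Rightarrow> ('o, 'm) irel \<Rightarrow> ('o, 'm) irel \<Rightarrow> bool" where
  "is_rel_meet C \<rho> \<sigma> \<mu> \<longleftrightarrow> is_relation C \<mu> \<and> rel_le C \<mu> \<rho> \<and> rel_le C \<mu> \<sigma>
     \<and> (\<forall>\<nu>. is_relation C \<nu> \<and> rel_le C \<nu> \<rho> \<and> rel_le C \<nu> \<sigma> \<longrightarrow> rel_le C \<nu> \<mu>)"

definition is_reflexive :: "('o, 'm) cat \<Rightarrow> ('o, 'm) irel \<Rightarrow> bool" where
  "is_reflexive C \<rho> \<longleftrightarrow> rel_le C (diag_rel C (Base \<rho>)) \<rho>"

definition is_symmetric :: "('o, 'm) cat \<Rightarrow> ('o, 'm) irel \<Rightarrow> bool" where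
  "is_symmetric C \<rho> \<longleftrightarrow> rel_le C (opp_rel \<rho>) \<rho>"

definition is_transitive :: "('o, 'm) cat \<Rightarrow> ('o, 'm) irel \<Rightarrow> bool" where
  "is_transitive C \<rho> \<longleftrightarrow>
     (\<exists>P p\<^sub>1 p\<^sub>2. is_pullback C (Leg2 \<rho>) (Leg1 \<rho>) P p\<^sub>1 p\<^sub>2
        \<and> (\<exists>\<tau> \<in> hom C P (Tip \<rho>).
             Leg1 \<rho> \<cdot>\<^bsub>C\<^esub> \<tau> = Leg1 \<rho> \<cdot>\<^bsub>C\<^esub> p\<^sub>1 \<and> Leg2 \<rho> \<cdot>\<^bsub>C\<^esub> \<tau> = Leg2 \<rho> \<cdot>\<^bsub>C\<^esub> p\<^sub>2))"

definition is_equivalence_rel :: "('o, 'm) cat \<Rightarrow> ('o, 'm) irel \<Rightarrow> bool" where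
  "is_equivalence_rel C \<rho> \<longleftrightarrow>
     is_relation C \<rho> \<and> is_reflexive C \<rho> \<and> is_symmetric C \<rho> \<and> is_transitive C \<rho>"

definition is_kernel_pair :: "('o, 'm) cat \<Rightarrow> 'm \<Rightarrow> ('o, 'm) irel \<Rightarrow> bool" where
  "is_kernel_pair C f \<rho> \<longleftrightarrow>
     f \<in> Arr C \<and> Dom C f = Base \<rho> \<and> is_pullback C f f (Tip \<rho>) (Leg1 \<rho>) (Leg2 \<rho>)"


section \<open>Barr-exact categories\<close>

locale exact_category = category +
  assumes finite_limits: "finitely_complete C"
    and factorization:
      "f \<in> Arr C \<Longrightarrow> \<exists>m e. is_regular_epi C e \<and> is_mono C m \<and> Cod C e = Dom C m \<and> f = m \<cdot> e"
    and regular_epi_stable: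
      "is_regular_epi C e \<Longrightarrow> is_pullback C e g P p q \<Longrightarrow> is_regular_epi C q"
    and effective: "is_equivalence_rel C \<rho> \<Longrightarrow> \<exists>f. is_kernel_pair C f \<rho>"


section \<open>Internal preorders and partial orders\<close>

definition is_preorder :: "('o, 'm) cat \<Rightarrow> ('o, 'm) irel \<Rightarrow> bool" where
  "is_preorder C \<rho> \<longleftrightarrow> is_relation C \<rho> \<and> is_reflexive C \<rho> \<and> is_transitive C \<rho>"

definition is_partial_order :: "('o, 'm) cat \<Rightarrow> ('o, 'm) irel \<Rightarrow> bool" where
  "is_partial_order C \<rho> \<longleftrightarrow> is_preorder C \<rho>
     \<and> (\<exists>\<mu>. is_rel_meet C \<rho> (opp_rel \<rho>) \<mu> \<and> rel_eq C \<mu> (diag_rel C (Base \<rho>)))"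

text \<open>
  A morphism \<open>(f, f\<^sup>-) : (A, \<rho>) \<rightarrow> (B, \<sigma>)\<close>; domain and codomain are recorded since they are not
  determined by \<open>Map = f\<close> and \<open>Lift = f\<^sup>-\<close>.
\<close>

record ('o, 'm) relmor =
  Src :: "('o, 'm) irel"
  Trg :: "('o, 'm) irel"
  Map :: 'm
  Lift :: 'm

definition is_preord_mor :: "('o, 'm) cat \<Rightarrow> ('o, 'm) relmor \<Rightarrow> bool" where
  "is_preord_mor C \<phi> \<longleftrightarrow> is_preorder C (Src \<phi>) \<and> is_preorder C (Trg \<phi>)
     \<and> Map \<phi> \<in> hom C (Base (Src \<phi>)) (Base (Trg \<phi>))
     \<and> Lift \<phi> \<in> hom C (Tip (Src \<phi>)) (Tip (Trg \<phi>))
     \<and> Map \<phi> \<cdot>\<^bsub>C\<^esub> Leg1 (Src \<phi>) = Leg1 (Trg \<phi>) \<cdot>\<^bsub>C\<^esub> Lift \<phi>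
     \<and> Map \<phi> \<cdot>\<^bsub>C\<^esub> Leg2 (Src \<phi>) = Leg2 (Trg \<phi>) \<cdot>\<^bsub>C\<^esub> Lift \<phi>"

definition PreOrd :: "('o, 'm) cat \<Rightarrow> (('o, 'm) irel, ('o, 'm) relmor) cat" where
  "PreOrd C =
     \<lparr>Obj = {\<rho>. is_preorder C \<rho>},
      Arr = {\<phi>. is_preord_mor C \<phi>},
      Dom = Src,
      Cod = Trg,
      Ide = (\<lambda>\<rho>. \<lparr>Src = \<rho>, Trg = \<rho>, Map = Ide C (Base \<rho>), Lift = Ide C (Tip \<rho>)\<rparr>),
      Comp = (\<lambda>\<psi> \<phi>. \<lparr>Src = Src \<phi>, Trg = Trg \<psi>,
                Map = Map \<psi> \<cdot>\<^bsub>C\<^esub> Map \<phi>, Lift = Lift \<psi> \<cdot>\<^bsub>C\<^esub> Lift \<phi>\<rparr>)\<rparr>"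

definition ParOrd :: "('o, 'm) cat \<Rightarrow> (('o, 'm) irel, ('o, 'm) relmor) cat" where
  "ParOrd C = full_subcat (PreOrd C) (is_partial_order C)"

definition ParOrd_incl ::
  "(('o, 'm) irel, ('o, 'm) relmor, ('o, 'm) irel, ('o, 'm) relmor) cat_functor" where
  "ParOrd_incl = \<lparr>Omap = (\<lambda>\<rho>. \<rho>), Amap = (\<lambda>\<phi>. \<phi>)\<rparr>"

end

theory Submission
  imports Defs
begin

text \<open>
  For a preorder \<open>(A, \<rho>)\<close> the relation \<open>\<rho> \<and> \<rho>\<^sup>o\<close> is an equivalence relation, hence by exactness the
  kernel pair of a regular epimorphism \<open>q : A \<rightarrow> Q\<close>. The regular image \<open>\<sigma>\<close> of \<open>\<rho>\<close> along \<open>q \<times> q\<close> is a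
  partial order, and \<open>(A, \<rho>) \<rightarrow> (Q, \<sigma>)\<close> is the reflection: a monotone map into a partial order
  identifies elements related by \<open>\<rho> \<and> \<rho>\<^sup>o\<close>, so it factors through \<open>q\<close>, and the factorization is
  monotone because \<open>\<rho> \<rightarrow> \<sigma>\<close> is a regular epimorphism. Relations are handled through generalized
  elements \<open>X \<rightarrow> A\<close>; a relation between such elements may be checked after precomposition with a
  regular epimorphism, and elements of \<open>Q\<close> lift to \<open>A\<close> after such a precomposition.
\<close>


section \<open>Reflections as universal arrows\<close>

lemma hom_full_subcat:
  "f \<in> hom (full_subcat D P) A B \<longleftrightarrow> f \<in> hom D A B \<and> P A \<and> P B"
  by (auto simp: hom_def full_subcat_def)

lemma category_full_subcat:
  assumes "category D"
  shows "category (full_subcat D P)"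
proof -
  interpret category D by fact
  have [simp]: "Comp (full_subcat D P) = Comp D" "Ide (full_subcat D P) = Ide D"
    "Dom (full_subcat D P) = Dom D" "Cod (full_subcat D P) = Cod D"
    by (simp_all add: full_subcat_def)
  show ?thesis
  proof
    fix f g h A B E G
    show "f \<in> Arr (full_subcat D P) \<Longrightarrow> Dom (full_subcat D P) f \<in> Obj (full_subcat D P)"
      by (auto simp: full_subcat_def Dom_closed)
    show "f \<in> Arr (full_subcat D P) \<Longrightarrow> Cod (full_subcat D P) f \<in> Obj (full_subcat D P)"
      by (auto simp: full_subcat_def Cod_closed)
    show "A \<in> Obj (full_subcat D P) \<Longrightarrow> Ide (full_subcat D P) A \<in> hom (full_subcat D P) A A"
      by (auto simp: hom_full_subcat Ide_closed) (auto simp: full_subcat_def Ide_closed)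
  qed (auto simp: hom_full_subcat Comp_closed Comp_Ide Ide_Comp Comp_assoc)
qed

text \<open>Uniqueness of extensions makes \<open>\<eta> A\<close> cancellable against arrows into
  objects satisfying \<open>P\<close>. Functoriality, naturality of the counit and the triangle
  identity at \<open>Omap F A\<close> are therefore checked after precomposition with a unit; the
  other laws hold by the choice of \<open>F\<close> and \<open>\<epsilon>\<close>. The inclusion can
  be \<open>id_functor\<close> because a full subcategory keeps the operations of
  \<open>D\<close>.\<close>

lemma universal_arrows_imp_adjunction:
  assumes "category D"
    and reflector: "\<And>A. A \<in> Obj D \<Longrightarrow> P (R A)"
    and unit: "\<And>A. A \<in> Obj D \<Longrightarrow> \<eta> A \<in> hom D A (R A)"
    and universal: "\<And>A B f. A \<in> Obj D \<Longrightarrow> P B \<Longrightarrow> f \<in> hom D A B \<Longrightarrow>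
      \<exists>!k. k \<in> hom D (R A) B \<and> k \<cdot>\<^bsub>D\<^esub> \<eta> A = f"
  shows "\<exists>F \<epsilon>. is_adjunction D (full_subcat D P) F id_functor \<eta> \<epsilon>"
proof -
  interpret category D by fact
  let ?S = "full_subcat D P"
  have [simp]: "Comp ?S = Comp D" "Ide ?S = Ide D" "Dom ?S = Dom D" "Cod ?S = Cod D"
    by (simp_all add: full_subcat_def)
  have ObjS: "A \<in> Obj ?S \<longleftrightarrow> A \<in> Obj D \<and> P A" for A by (simp add: full_subcat_def)
  have ArrS: "f \<in> Arr ?S \<longleftrightarrow> f \<in> Arr D \<and> P (Dom D f) \<and> P (Cod D f)" for f
    by (simp add: full_subcat_def)
  have catS: "category ?S" using \<open>category D\<close> by (rule category_full_subcat)
  have Arr_hom: "f \<in> hom D (Dom D f) (Cod D f)" if "f \<in> Arr D" for f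
    using that by (simp add: hom_def)
  have hom_Obj: "A \<in> Obj D" "B \<in> Obj D" if "f \<in> hom D A B" for f A B
    using that by (auto simp: hom_def Dom_closed Cod_closed)
  \<comment> \<open>The extension of \<open>f\<close> along \<open>\<eta> A\<close>; the
    \<open>THE\<close> is meaningful exactly where \<open>universal\<close> supplies a unique
    solution.\<close>
  define ext where "ext A B f = (THE k. k \<in> hom D (R A) B \<and> k \<cdot>\<^bsub>D\<^esub> \<eta> A = f)" for A B f
  have ext: "ext A B f \<in> hom D (R A) B" "ext A B f \<cdot>\<^bsub>D\<^esub> \<eta> A = f"
    if "A \<in> Obj D" "P B" "f \<in> hom D A B" for A B f
    using theI'[OF universal[OF that]] by (auto simp: ext_def)
  have unique: "k = l"
    if "A \<in> Obj D" "P B" "k \<in> hom D (R A) B" "l \<in> hom D (R A) B" "k \<cdot>\<^bsub>D\<^esub> \<eta> A = l \<cdot>\<^bsub>D\<^esub> \<eta> A"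
    for A B k l
  proof -
    have "k \<cdot>\<^bsub>D\<^esub> \<eta> A \<in> hom D A B" using unit[OF that(1)] that(3) by (rule Comp_closed)
    then show ?thesis using universal[OF that(1,2)] that by metis
  qed
  \<comment> \<open>The action on arrows is forced by naturality of the unit: the image of
    \<open>f : A \<rightarrow> B\<close> must extend \<open>\<eta> B \<cdot> f\<close> along
    \<open>\<eta> A\<close>.\<close>
  define F where
    "F = \<lparr>Omap = R, Amap = \<lambda>f. ext (Dom D f) (R (Cod D f)) (\<eta> (Cod D f) \<cdot>\<^bsub>D\<^esub> f)\<rparr>"
  \<comment> \<open>Extending the identity of \<open>B\<close> along \<open>\<eta> B\<close> builds
    in the triangle identity at \<open>B\<close>.\<close>
  define \<epsilon> where "\<epsilon> B = ext B B (Ide D B)" for B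
  have R_Obj: "R A \<in> Obj D" if "A \<in> Obj D" for A
    using unit[OF that] by (rule hom_Obj)
  have FO [simp]: "Omap F A = R A" for A by (simp add: F_def)
  have FA: "Amap F f \<in> hom D (R A) (R B)" "Amap F f \<cdot>\<^bsub>D\<^esub> \<eta> A = \<eta> B \<cdot>\<^bsub>D\<^esub> f"
    if f: "f \<in> hom D A B" for f A B
  proof -
    have "\<eta> B \<cdot>\<^bsub>D\<^esub> f \<in> hom D A (R B)" using f unit hom_Obj[OF f] Comp_closed by blast
    moreover have "Dom D f = A" "Cod D f = B" using f by (auto simp: hom_def)
    ultimately show "Amap F f \<in> hom D (R A) (R B)" "Amap F f \<cdot>\<^bsub>D\<^esub> \<eta> A = \<eta> B \<cdot>\<^bsub>D\<^esub> f"
      using ext[of A "R B" "\<eta> B \<cdot>\<^bsub>D\<^esub> f"] hom_Obj[OF f] reflector by (auto simp: F_def)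
  qed
  have F_Ide: "Amap F (Ide D A) = Ide D (R A)" if A: "A \<in> Obj D" for A
  proof (rule unique[OF A reflector[OF A]])
    show "Amap F (Ide D A) \<in> hom D (R A) (R A)" using FA(1) Ide_closed[OF A] .
    show "Ide D (R A) \<in> hom D (R A) (R A)" using Ide_closed R_Obj[OF A] .
    show "Amap F (Ide D A) \<cdot>\<^bsub>D\<^esub> \<eta> A = Ide D (R A) \<cdot>\<^bsub>D\<^esub> \<eta> A"
      using FA(2)[OF Ide_closed[OF A]] Comp_Ide[OF unit[OF A]] Ide_Comp[OF unit[OF A]] by simp
  qed
  have F_Comp: "Amap F (g \<cdot>\<^bsub>D\<^esub> f) = Amap F g \<cdot>\<^bsub>D\<^esub> Amap F f"
    if f: "f \<in> hom D A B" and g: "g \<in> hom D B E" for f g A B E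
  proof -
    note gf = Comp_closed[OF f g]
    have A: "A \<in> Obj D" and B: "B \<in> Obj D" and E: "E \<in> Obj D"
      using hom_Obj f g by blast+
    have "Amap F (g \<cdot>\<^bsub>D\<^esub> f) \<cdot>\<^bsub>D\<^esub> \<eta> A = (\<eta> E \<cdot>\<^bsub>D\<^esub> g) \<cdot>\<^bsub>D\<^esub> f"
      using FA(2)[OF gf] Comp_assoc[OF f g unit[OF E]] by simp
    also have "\<dots> = Amap F g \<cdot>\<^bsub>D\<^esub> (\<eta> B \<cdot>\<^bsub>D\<^esub> f)"
      using FA(2)[OF g] Comp_assoc[OF f unit[OF B] FA(1)[OF g]] by simp
    also have "\<dots> = (Amap F g \<cdot>\<^bsub>D\<^esub> Amap F f) \<cdot>\<^bsub>D\<^esub> \<eta> A"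
      using FA(2)[OF f] Comp_assoc[OF unit[OF A] FA(1)[OF f] FA(1)[OF g]] by simp
    finally show ?thesis
      using unique[OF A reflector[OF E] FA(1)[OF gf] Comp_closed[OF FA(1)[OF f] FA(1)[OF g]]]
      by blast
  qed
  have \<epsilon>: "\<epsilon> B \<in> hom D (R B) B" "\<epsilon> B \<cdot>\<^bsub>D\<^esub> \<eta> B = Ide D B" if "B \<in> Obj D" "P B" for B
    using ext[OF that Ide_closed[OF that(1)]] by (auto simp: \<epsilon>_def)
  have F_functor: "is_functor D ?S F"
    unfolding is_functor_def
  proof (intro conjI ballI impI)
    fix f g assume "f \<in> Arr D" "g \<in> Arr D" "Dom D g = Cod D f"
    then show "Amap F (g \<cdot>\<^bsub>D\<^esub> f) = Amap F g \<cdot>\<^bsub>?S\<^esub> Amap F f"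
      using F_Comp Arr_hom by simp metis
  qed (use \<open>category D\<close> catS in \<open>auto simp: ObjS hom_full_subcat R_Obj reflector F_Ide
      FA(1)[OF Arr_hom] Dom_closed Cod_closed\<close>)
  have U_functor: "is_functor ?S D id_functor"
    using \<open>category D\<close> catS by (auto simp: is_functor_def id_functor_def ObjS ArrS hom_def)
  have id_D: "is_functor D D id_functor"
    using \<open>category D\<close> by (auto simp: is_functor_def id_functor_def hom_def)
  have id_S: "is_functor ?S ?S id_functor"
    using catS by (auto simp: is_functor_def id_functor_def hom_def)
  have UF: "is_functor D D (comp_functor id_functor F)"
    using F_functor \<open>category D\<close>
    by (auto simp: is_functor_def comp_functor_def id_functor_def ObjS hom_full_subcat)
  have FU: "is_functor ?S ?S (comp_functor F id_functor)"
    using F_functor catS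
    by (auto simp: is_functor_def comp_functor_def id_functor_def ObjS ArrS)
  have "is_adjunction D ?S F id_functor \<eta> \<epsilon>"
    unfolding is_adjunction_def
  proof (intro conjI ballI)
    show "is_nat_trans D D id_functor (comp_functor id_functor F) \<eta>"
      using id_D UF unit FA(2)[OF Arr_hom]
      by (auto simp: is_nat_trans_def comp_functor_def id_functor_def)
    have "\<epsilon> (Cod D f) \<cdot>\<^bsub>D\<^esub> Amap F f = f \<cdot>\<^bsub>D\<^esub> \<epsilon> (Dom D f)" if "f \<in> Arr ?S" for f
    proof -
      define A B where "A = Dom D f" and "B = Cod D f"
      have f: "f \<in> hom D A B" and P: "P A" "P B" using that by (auto simp: ArrS hom_def A_def B_def)
      have A: "A \<in> Obj D" and B: "B \<in> Obj D" using hom_Obj[OF f] by auto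
      \<comment> \<open>Both sides of the naturality square reduce to \<open>f\<close> after
        precomposition with \<open>\<eta> A\<close>.\<close>
      have "(\<epsilon> B \<cdot>\<^bsub>D\<^esub> Amap F f) \<cdot>\<^bsub>D\<^esub> \<eta> A = \<epsilon> B \<cdot>\<^bsub>D\<^esub> (\<eta> B \<cdot>\<^bsub>D\<^esub> f)"
        using FA(2)[OF f] Comp_assoc[OF unit[OF A] FA(1)[OF f] \<epsilon>(1)[OF B P(2)]] by simp
      also have "\<dots> = f"
        using Comp_assoc[OF f unit[OF B] \<epsilon>(1)[OF B P(2)]] \<epsilon>(2)[OF B P(2)] Ide_Comp[OF f] by simp
      also have "\<dots> = (f \<cdot>\<^bsub>D\<^esub> \<epsilon> A) \<cdot>\<^bsub>D\<^esub> \<eta> A"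
        using Comp_assoc[OF unit[OF A] \<epsilon>(1)[OF A P(1)] f] \<epsilon>(2)[OF A P(1)] Comp_Ide[OF f] by simp
      finally have "\<epsilon> B \<cdot>\<^bsub>D\<^esub> Amap F f = f \<cdot>\<^bsub>D\<^esub> \<epsilon> A"
        using unique[OF A P(2) Comp_closed[OF FA(1)[OF f] \<epsilon>(1)[OF B P(2)]]
            Comp_closed[OF \<epsilon>(1)[OF A P(1)] f]] by blast
      then show ?thesis by (simp add: A_def B_def)
    qed
    then show "is_nat_trans ?S ?S (comp_functor F id_functor) id_functor \<epsilon>"
      using id_S FU \<epsilon>
      by (auto simp: is_nat_trans_def comp_functor_def id_functor_def hom_full_subcat ObjS R_Obj reflector)
  next
    fix A assume A: "A \<in> Obj D"
    note RA = R_Obj[OF A] and PA = reflector[OF A]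
    have "(\<epsilon> (R A) \<cdot>\<^bsub>D\<^esub> Amap F (\<eta> A)) \<cdot>\<^bsub>D\<^esub> \<eta> A = \<epsilon> (R A) \<cdot>\<^bsub>D\<^esub> (\<eta> (R A) \<cdot>\<^bsub>D\<^esub> \<eta> A)"
      using Comp_assoc[OF unit[OF A] FA(1)[OF unit[OF A]] \<epsilon>(1)[OF RA PA]] FA(2)[OF unit[OF A]]
      by simp
    also have "\<dots> = Ide D (R A) \<cdot>\<^bsub>D\<^esub> \<eta> A"
      using Comp_assoc[OF unit[OF A] unit[OF RA] \<epsilon>(1)[OF RA PA]] \<epsilon>(2)[OF RA PA] by simp
    finally show "\<epsilon> (Omap F A) \<cdot>\<^bsub>?S\<^esub> Amap F (\<eta> A) = Ide ?S (Omap F A)"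
      using unique[OF A PA Comp_closed[OF FA(1)[OF unit[OF A]] \<epsilon>(1)[OF RA PA]] Ide_closed[OF RA]]
      by simp
  next
    fix B assume "B \<in> Obj ?S"
    then show "Amap id_functor (\<epsilon> B) \<cdot>\<^bsub>D\<^esub> \<eta> (Omap id_functor B) = Ide D (Omap id_functor B)"
      using \<epsilon>(2) by (simp add: ObjS id_functor_def)
  qed (use F_functor U_functor in auto)
  then show ?thesis by blast
qed

text \<open>The transpose \<open>\<epsilon> B \<cdot> Amap F f\<close> extends \<open>f\<close> by
  naturality of the unit and the triangle identity at \<open>B\<close>; naturality of the counit and
  the triangle identity at \<open>A\<close> recover any extension \<open>k\<close> from
  \<open>f\<close>. This gives access to an arbitrary adjunction, as a claim about every unit
  requires.\<close>

lemma adjunction_imp_universal_arrows: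
  assumes adj: "is_adjunction D (full_subcat D P) F id_functor \<eta> \<epsilon>" and A: "A \<in> Obj D"
  shows "P (Omap F A)" "\<eta> A \<in> hom D A (Omap F A)"
    "P B \<Longrightarrow> f \<in> hom D A B \<Longrightarrow> \<exists>!k. k \<in> hom D (Omap F A) B \<and> k \<cdot>\<^bsub>D\<^esub> \<eta> A = f"
proof -
  let ?S = "full_subcat D P"
  have [simp]: "Comp ?S = Comp D" "Ide ?S = Ide D" "Dom ?S = Dom D" "Cod ?S = Cod D"
    by (simp_all add: full_subcat_def)
  have ObjS: "B \<in> Obj ?S \<longleftrightarrow> B \<in> Obj D \<and> P B" for B by (simp add: full_subcat_def)
  have F: "is_functor D ?S F" and \<eta>: "is_nat_trans D D id_functor (comp_functor id_functor F) \<eta>"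
    and \<epsilon>: "is_nat_trans ?S ?S (comp_functor F id_functor) id_functor \<epsilon>"
    and tri1: "\<And>A. A \<in> Obj D \<Longrightarrow> \<epsilon> (Omap F A) \<cdot>\<^bsub>D\<^esub> Amap F (\<eta> A) = Ide D (Omap F A)"
    and tri2: "\<And>B. B \<in> Obj D \<Longrightarrow> P B \<Longrightarrow> \<epsilon> B \<cdot>\<^bsub>D\<^esub> \<eta> B = Ide D B"
    using adj by (auto simp: is_adjunction_def id_functor_def ObjS)
  interpret category D using F by (simp add: is_functor_def)
  show PF: "P (Omap F A)" using F A by (auto simp: is_functor_def ObjS)
  show unit: "\<eta> A \<in> hom D A (Omap F A)"
    using \<eta> A by (auto simp: is_nat_trans_def comp_functor_def id_functor_def)
  assume PB: "P B" and f: "f \<in> hom D A B"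
  have B: "B \<in> Obj D" using f Cod_closed by (auto simp: hom_def)
  have FO: "Omap F A \<in> Obj D" using F A by (auto simp: is_functor_def ObjS)
  have unitB: "\<eta> B \<in> hom D B (Omap F B)"
    using \<eta> B by (auto simp: is_nat_trans_def comp_functor_def id_functor_def)
  have FA: "Amap F g \<in> hom D (Omap F X) (Omap F Y)" if "g \<in> hom D X Y" for g X Y
    using F that unfolding is_functor_def hom_full_subcat by (auto simp: hom_def)
  have \<epsilon>B: "\<epsilon> X \<in> hom D (Omap F X) X" if "X \<in> Obj D" "P X" for X
    using \<epsilon> that by (auto simp: is_nat_trans_def comp_functor_def id_functor_def ObjS hom_full_subcat)
  have nat\<eta>: "\<eta> B \<cdot>\<^bsub>D\<^esub> f = Amap F f \<cdot>\<^bsub>D\<^esub> \<eta> A"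
    using \<eta> f by (auto simp: is_nat_trans_def comp_functor_def id_functor_def hom_def)
  have nat\<epsilon>: "\<epsilon> B \<cdot>\<^bsub>D\<^esub> Amap F k = k \<cdot>\<^bsub>D\<^esub> \<epsilon> (Omap F A)" if k: "k \<in> hom D (Omap F A) B" for k
  proof -
    have "k \<in> Arr ?S" using k PF PB by (auto simp: full_subcat_def hom_def)
    then have "\<epsilon> (Cod D k) \<cdot>\<^bsub>D\<^esub> Amap F k = k \<cdot>\<^bsub>D\<^esub> \<epsilon> (Dom D k)"
      using \<epsilon> by (auto simp: is_nat_trans_def comp_functor_def id_functor_def)
    then show ?thesis using k by (simp add: hom_def)
  qed
  show "\<exists>!k. k \<in> hom D (Omap F A) B \<and> k \<cdot>\<^bsub>D\<^esub> \<eta> A = f"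
  proof (rule ex1I[of _ "\<epsilon> B \<cdot>\<^bsub>D\<^esub> Amap F f"], intro conjI)
    show "\<epsilon> B \<cdot>\<^bsub>D\<^esub> Amap F f \<in> hom D (Omap F A) B"
      using FA[OF f] \<epsilon>B[OF B PB] by (rule Comp_closed)
    show "(\<epsilon> B \<cdot>\<^bsub>D\<^esub> Amap F f) \<cdot>\<^bsub>D\<^esub> \<eta> A = f"
      using Comp_assoc[OF unit FA[OF f] \<epsilon>B[OF B PB]] nat\<eta> Comp_assoc[OF f unitB \<epsilon>B[OF B PB]]
        tri2[OF B PB] Ide_Comp[OF f] by simp
  next
    fix k assume k: "k \<in> hom D (Omap F A) B \<and> k \<cdot>\<^bsub>D\<^esub> \<eta> A = f"
    then have kh: "k \<in> hom D (Omap F A) B" by simp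
    have "Amap F (k \<cdot>\<^bsub>D\<^esub> \<eta> A) = Amap F k \<cdot>\<^bsub>D\<^esub> Amap F (\<eta> A)"
      using F kh unit by (auto simp: is_functor_def hom_def)
    then have "\<epsilon> B \<cdot>\<^bsub>D\<^esub> Amap F f = (\<epsilon> B \<cdot>\<^bsub>D\<^esub> Amap F k) \<cdot>\<^bsub>D\<^esub> Amap F (\<eta> A)"
      using k Comp_assoc[OF FA[OF unit] FA[OF kh] \<epsilon>B[OF B PB]] by simp
    also have "\<dots> = k"
      using nat\<epsilon>[OF kh] Comp_assoc[OF FA[OF unit] \<epsilon>B[OF FO PF] kh] tri1[OF A] Comp_Ide[OF kh]
      by simp
    finally show "k = \<epsilon> B \<cdot>\<^bsub>D\<^esub> Amap F f" by simp
  qed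
qed

text \<open>Universal arrows out of \<open>A\<close> are unique up to isomorphism under
  \<open>A\<close>, and a coequalizer can be transported along such an isomorphism. The transport is
  needed because \<open>e\<close> is universal only against objects satisfying \<open>P\<close>,
  whereas a coequalizer is tested against every object of \<open>D\<close>.\<close>

lemma universal_arrow_coequalizer:
  assumes "category D"
    and q: "is_coequalizer D f g q" "q \<in> hom D A Q" "P Q"
    and q_universal: "\<And>B h. P B \<Longrightarrow> h \<in> hom D A B \<Longrightarrow> \<exists>!k. k \<in> hom D Q B \<and> k \<cdot>\<^bsub>D\<^esub> q = h"
    and e: "e \<in> hom D A E" "P E"
    and e_universal: "\<And>B h. P B \<Longrightarrow> h \<in> hom D A B \<Longrightarrow> \<exists>!k. k \<in> hom D E B \<and> k \<cdot>\<^bsub>D\<^esub> e = h"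
  shows "is_coequalizer D f g e"
proof -
  interpret category D by fact
  obtain i where i: "i \<in> hom D Q E" "i \<cdot>\<^bsub>D\<^esub> q = e" using q_universal[OF e(2,1)] by blast
  obtain j where j: "j \<in> hom D E Q" "j \<cdot>\<^bsub>D\<^esub> e = q" using e_universal[OF q(3,2)] by blast
  have E: "E \<in> Obj D" using e Cod_closed by (auto simp: hom_def)
  \<comment> \<open>Both \<open>i \<cdot> j\<close> and the identity of \<open>E\<close> factor
    \<open>e\<close> through itself, and \<open>E\<close> satisfies \<open>P\<close>.\<close>
  have "(i \<cdot>\<^bsub>D\<^esub> j) \<cdot>\<^bsub>D\<^esub> e = Ide D E \<cdot>\<^bsub>D\<^esub> e"
    using Comp_assoc[OF e(1) j(1) i(1)] Ide_Comp[OF e(1)] i j by simp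
  then have ij: "i \<cdot>\<^bsub>D\<^esub> j = Ide D E"
    using e_universal[OF e(2,1)] Comp_closed[OF j(1) i(1)] Ide_closed[OF E] Ide_Comp[OF e(1)]
    by metis
  have A: "A = Cod D f" using q by (auto simp: is_coequalizer_def hom_def)
  have codQ: "Cod D q = Q" and domE: "Dom D e = A" "Cod D e = E" "e \<in> Arr D"
    using q e by (auto simp: hom_def)
  have fg: "f \<in> hom D (Dom D f) A" "g \<in> hom D (Dom D f) A" "q \<cdot>\<^bsub>D\<^esub> f = q \<cdot>\<^bsub>D\<^esub> g"
    using q by (auto simp: is_coequalizer_def hom_def)
  have "e \<cdot>\<^bsub>D\<^esub> f = e \<cdot>\<^bsub>D\<^esub> g"
    using Comp_assoc[OF fg(1) q(2) i(1)] Comp_assoc[OF fg(2) q(2) i(1)] fg(3) i by simp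
  moreover have "\<exists>!k. k \<in> hom D E Y \<and> k \<cdot>\<^bsub>D\<^esub> e = h"
    if h: "h \<in> hom D A Y" "h \<cdot>\<^bsub>D\<^esub> f = h \<cdot>\<^bsub>D\<^esub> g" for Y h
  proof -
    have "\<exists>!k. k \<in> hom D Q Y \<and> k \<cdot>\<^bsub>D\<^esub> q = h"
      using q(1) h unfolding is_coequalizer_def A[symmetric] codQ by blast
    then obtain k where k: "k \<in> hom D Q Y" "k \<cdot>\<^bsub>D\<^esub> q = h"
      and uniq: "\<And>l. l \<in> hom D Q Y \<Longrightarrow> l \<cdot>\<^bsub>D\<^esub> q = h \<Longrightarrow> l = k" by auto
    show ?thesis
    proof (rule ex1I[of _ "k \<cdot>\<^bsub>D\<^esub> j"], intro conjI)
      show "k \<cdot>\<^bsub>D\<^esub> j \<in> hom D E Y" using j(1) k(1) by (rule Comp_closed)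
      show "(k \<cdot>\<^bsub>D\<^esub> j) \<cdot>\<^bsub>D\<^esub> e = h" using Comp_assoc[OF e(1) j(1) k(1)] j k by simp
    next
      fix l assume l: "l \<in> hom D E Y \<and> l \<cdot>\<^bsub>D\<^esub> e = h"
      then have lh: "l \<in> hom D E Y" by simp
      \<comment> \<open>Precomposing with \<open>i\<close> turns a factorization through
        \<open>e\<close> into one through \<open>q\<close>, where uniqueness is known;
        \<open>j\<close> then undoes \<open>i\<close>.\<close>
      have "l \<cdot>\<^bsub>D\<^esub> i = k"
        using uniq[OF Comp_closed[OF i(1) lh]] Comp_assoc[OF q(2) i(1) lh] i l by simp
      then show "l = k \<cdot>\<^bsub>D\<^esub> j"
        using Comp_assoc[OF j(1) i(1) lh] ij Comp_Ide[OF lh] by simp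
    qed
  qed
  ultimately show ?thesis
    using q(1) unfolding is_coequalizer_def A[symmetric] domE(1,2) by (simp add: domE(3))
qed


section \<open>Regular epimorphisms and relations\<close>

text \<open>The arrows \<open>a\<close> and \<open>b\<close> out of \<open>X\<close> are generalized
  elements of the base at stage \<open>X\<close>; the condition says that the pair
  \<open><a, b>\<close> factors through the subobject. It permits elementwise reasoning about
  internal relations.\<close>

definition related :: "('o, 'm) cat \<Rightarrow> ('o, 'm) irel \<Rightarrow> 'o \<Rightarrow> 'm \<Rightarrow> 'm \<Rightarrow> bool" where
  "related C \<rho> X a b \<longleftrightarrow>
     (\<exists>h \<in> hom C X (Tip \<rho>). Leg1 \<rho> \<cdot>\<^bsub>C\<^esub> h = a \<and> Leg2 \<rho> \<cdot>\<^bsub>C\<^esub> h = b)"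

lemma is_relation_legs:
  "is_relation C \<rho> \<Longrightarrow> Leg1 \<rho> \<in> hom C (Tip \<rho>) (Base \<rho>)"
  "is_relation C \<rho> \<Longrightarrow> Leg2 \<rho> \<in> hom C (Tip \<rho>) (Base \<rho>)"
  by (auto simp: is_relation_def)

lemma is_regular_epi_Arr: "is_regular_epi C e \<Longrightarrow> e \<in> Arr C"
  by (auto simp: is_regular_epi_def is_coequalizer_def)

context category
begin

lemma hom_Obj: "f \<in> hom C A B \<Longrightarrow> A \<in> Obj C" "f \<in> hom C A B \<Longrightarrow> B \<in> Obj C"
  by (auto simp: hom_def Dom_closed Cod_closed)

text \<open>Product projections separate arrows into \<open>P\<close>, so \<open>m \<cdot> u\<close>
  and \<open>m \<cdot> v\<close> agree, and \<open>m\<close> is monic.\<close>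

lemma is_relation_jointly_monic:
  assumes rel: "is_relation C \<rho>" and u: "u \<in> hom C X (Tip \<rho>)" and v: "v \<in> hom C X (Tip \<rho>)"
    and eq: "Leg1 \<rho> \<cdot> u = Leg1 \<rho> \<cdot> v" "Leg2 \<rho> \<cdot> u = Leg2 \<rho> \<cdot> v"
  shows "u = v"
proof -
  obtain P p q m where P: "is_product C (Base \<rho>) (Base \<rho>) P p q" and m: "m \<in> hom C (Tip \<rho>) P"
    "is_mono C m" "p \<cdot> m = Leg1 \<rho>" "q \<cdot> m = Leg2 \<rho>"
    using rel by (auto simp: is_relation_def)
  have pq: "p \<in> hom C P (Base \<rho>)" "q \<in> hom C P (Base \<rho>)" using P by (auto simp: is_product_def)
  have mu: "m \<cdot> u \<in> hom C X P" and mv: "m \<cdot> v \<in> hom C X P" using u v m Comp_closed by auto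
  have "p \<cdot> (m \<cdot> u) = p \<cdot> (m \<cdot> v)" "q \<cdot> (m \<cdot> u) = q \<cdot> (m \<cdot> v)"
    using eq m Comp_assoc[OF u m(1) pq(1)] Comp_assoc[OF v m(1) pq(1)]
      Comp_assoc[OF u m(1) pq(2)] Comp_assoc[OF v m(1) pq(2)] by auto
  moreover have "p \<cdot> (m \<cdot> u) \<in> hom C X (Base \<rho>)" "q \<cdot> (m \<cdot> u) \<in> hom C X (Base \<rho>)"
    using mu pq Comp_closed by blast+
  ultimately have "m \<cdot> u = m \<cdot> v" using P mu mv unfolding is_product_def by metis
  moreover have "Dom C m = Tip \<rho>" using m by (simp add: hom_def)
  ultimately show ?thesis using m(2) u v unfolding is_mono_def by metis
qed

lemma related_comp:
  assumes "related C \<rho> X a b" and t: "t \<in> hom C Y X"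
    and legs: "Leg1 \<rho> \<in> hom C (Tip \<rho>) (Base \<rho>)" "Leg2 \<rho> \<in> hom C (Tip \<rho>) (Base \<rho>)"
  shows "related C \<rho> Y (a \<cdot> t) (b \<cdot> t)"
proof -
  obtain h where h: "h \<in> hom C X (Tip \<rho>)" "Leg1 \<rho> \<cdot> h = a" "Leg2 \<rho> \<cdot> h = b"
    using assms by (auto simp: related_def)
  show ?thesis
    unfolding related_def using Comp_closed[OF t h(1)] Comp_assoc[OF t h(1) legs(1)]
      Comp_assoc[OF t h(1) legs(2)] h by auto
qed

text \<open>The generic related pair, witnessed by the identity of the tip. Every other related pair
  is a restriction of it, so inclusions of relations are decided on this one pair.\<close>

lemma related_tip:
  assumes "is_relation C \<rho>"
  shows "related C \<rho> (Tip \<rho>) (Leg1 \<rho>) (Leg2 \<rho>)"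
  using is_relation_legs[OF assms] unfolding related_def
  by (metis Comp_Ide Ide_closed hom_Obj(1))

lemma rel_le_iff_related:
  "rel_le C \<rho> \<sigma> \<longleftrightarrow> Base \<rho> = Base \<sigma> \<and> related C \<sigma> (Tip \<rho>) (Leg1 \<rho>) (Leg2 \<rho>)"
  by (auto simp: rel_le_def related_def)

lemma related_mono:
  assumes le: "rel_le C \<rho> \<sigma>" and \<rho>: "related C \<rho> X a b"
    and legs: "Leg1 \<sigma> \<in> hom C (Tip \<sigma>) (Base \<sigma>)" "Leg2 \<sigma> \<in> hom C (Tip \<sigma>) (Base \<sigma>)"
  shows "related C \<sigma> X a b"
proof -
  obtain h where "h \<in> hom C X (Tip \<rho>)" "Leg1 \<rho> \<cdot> h = a" "Leg2 \<rho> \<cdot> h = b"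
    using \<rho> by (auto simp: related_def)
  then show ?thesis using related_comp[of \<sigma> "Tip \<rho>"] le legs by (auto simp: rel_le_iff_related)
qed

section \<open>Descent along regular epimorphisms\<close>

lemma is_regular_epi_epi:
  assumes e: "is_regular_epi C e" "e \<in> hom C X Y"
    and "u \<in> hom C Y Z" "v \<in> hom C Y Z" "u \<cdot> e = v \<cdot> e"
  shows "u = v"
proof -
  obtain f g where fg: "is_coequalizer C f g e" using e by (auto simp: is_regular_epi_def)
  then have h: "f \<in> hom C (Dom C f) X" "g \<in> hom C (Dom C f) X" "e \<cdot> f = e \<cdot> g"
    using e(2) by (auto simp: is_coequalizer_def hom_def)
  \<comment> \<open>The arrow \<open>u \<cdot> e\<close> coequalizes the pair defining
    \<open>e\<close>, so it has only one factorization through \<open>e\<close>; both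
    \<open>u\<close> and \<open>v\<close> are one.\<close>
  have "(u \<cdot> e) \<cdot> f = (u \<cdot> e) \<cdot> g"
    using Comp_assoc[OF h(1) e(2) assms(3)] Comp_assoc[OF h(2) e(2) assms(3)] h(3) by simp
  moreover have "u \<cdot> e \<in> hom C X Z" using e(2) assms(3) by (rule Comp_closed)
  ultimately show ?thesis
    using fg assms e(2) unfolding is_coequalizer_def hom_def by (smt (verit) mem_Collect_eq)
qed

text \<open>The pair coequalized by \<open>q\<close> is itself identified by \<open>q\<close>, so
  \<open>ker\<close> applies to it. This replaces the unknown coequalized pair by a condition on all
  generalized elements that \<open>q\<close> identifies.\<close>

lemma is_regular_epi_factor:
  assumes q: "is_regular_epi C q" "q \<in> hom C A Q" and h: "h \<in> hom C A Y"
    and ker: "\<And>X u v. u \<in> hom C X A \<Longrightarrow> v \<in> hom C X A \<Longrightarrow> q \<cdot> u = q \<cdot> v \<Longrightarrow> h \<cdot> u = h \<cdot> v"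
  shows "\<exists>k \<in> hom C Q Y. k \<cdot> q = h"
proof -
  obtain f g where fg: "is_coequalizer C f g q" using q by (auto simp: is_regular_epi_def)
  then have hfg: "h \<cdot> f = h \<cdot> g"
    using q(2) by (intro ker[of _ "Dom C f"]) (auto simp: is_coequalizer_def hom_def)
  have cod: "Cod C f = A" "Cod C q = Q" using fg q(2) by (auto simp: is_coequalizer_def hom_def)
  have "\<exists>!k. k \<in> hom C Q Y \<and> k \<cdot> q = h"
    using fg h hfg unfolding is_coequalizer_def cod by blast
  then show ?thesis by blast
qed

text \<open>Orthogonality of regular epimorphisms to monomorphisms into \<open>A \<times> A\<close>.\<close>

lemma related_local:
  assumes e: "is_regular_epi C e" "e \<in> hom C Y X" and rel: "is_relation C \<rho>"
    and a: "a \<in> hom C X (Base \<rho>)" and b: "b \<in> hom C X (Base \<rho>)"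
    and loc: "related C \<rho> Y (a \<cdot> e) (b \<cdot> e)"
  shows "related C \<rho> X a b"
proof -
  note legs = is_relation_legs[OF rel]
  obtain h where h: "h \<in> hom C Y (Tip \<rho>)" "Leg1 \<rho> \<cdot> h = a \<cdot> e" "Leg2 \<rho> \<cdot> h = b \<cdot> e"
    using loc by (auto simp: related_def)
  \<comment> \<open>The composites of \<open>h\<close> with the legs factor through
    \<open>e\<close>, and the legs are jointly monic, so \<open>h\<close> identifies whatever
    \<open>e\<close> identifies and descends along \<open>e\<close>.\<close>
  have "h \<cdot> u = h \<cdot> v" if uv: "u \<in> hom C Z Y" "v \<in> hom C Z Y" "e \<cdot> u = e \<cdot> v" for Z u v
  proof (rule is_relation_jointly_monic[OF rel])
    show "h \<cdot> u \<in> hom C Z (Tip \<rho>)" "h \<cdot> v \<in> hom C Z (Tip \<rho>)"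
      using uv h(1) Comp_closed by blast+
    show "Leg1 \<rho> \<cdot> h \<cdot> u = Leg1 \<rho> \<cdot> h \<cdot> v" "Leg2 \<rho> \<cdot> h \<cdot> u = Leg2 \<rho> \<cdot> h \<cdot> v"
      using Comp_assoc[OF uv(1) h(1) legs(1)] Comp_assoc[OF uv(2) h(1) legs(1)]
        Comp_assoc[OF uv(1) h(1) legs(2)] Comp_assoc[OF uv(2) h(1) legs(2)]
        Comp_assoc[OF uv(1) e(2) a] Comp_assoc[OF uv(2) e(2) a]
        Comp_assoc[OF uv(1) e(2) b] Comp_assoc[OF uv(2) e(2) b] uv(3) h(2,3)
      by auto
  qed
  then obtain k where k: "k \<in> hom C X (Tip \<rho>)" "k \<cdot> e = h"
    using is_regular_epi_factor[OF e h(1)] by blast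
  \<comment> \<open>The legs of the descended witness are checked after precomposition with the
    epimorphism \<open>e\<close>.\<close>
  have "Leg1 \<rho> \<cdot> k = a" "Leg2 \<rho> \<cdot> k = b"
    using is_regular_epi_epi[OF e Comp_closed[OF k(1) legs(1)] a]
      is_regular_epi_epi[OF e Comp_closed[OF k(1) legs(2)] b]
      Comp_assoc[OF e(2) k(1)] legs h k(2) by auto
  then show ?thesis using k(1) by (auto simp: related_def)
qed

lemma is_preorder_refl:
  assumes pre: "is_preorder C \<rho>" and a: "a \<in> hom C X (Base \<rho>)"
  shows "related C \<rho> X a a"
proof -
  have "is_relation C \<rho>" "related C \<rho> (Base \<rho>) (Ide C (Base \<rho>)) (Ide C (Base \<rho>))"
    using pre by (auto simp: is_preorder_def is_reflexive_def rel_le_iff_related diag_rel_def)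
  then show ?thesis
    using related_comp[OF _ a] is_relation_legs Ide_Comp[OF a] by metis
qed

lemma is_transitive_related:
  assumes rel: "is_relation C \<rho>" and trans: "is_transitive C \<rho>"
    and ab: "related C \<rho> X a b" and bc: "related C \<rho> X b c"
  shows "related C \<rho> X a c"
proof -
  note legs = is_relation_legs[OF rel]
  obtain P p1 p2 t where P: "is_pullback C (Leg2 \<rho>) (Leg1 \<rho>) P p1 p2"
    and t: "t \<in> hom C P (Tip \<rho>)" "Leg1 \<rho> \<cdot> t = Leg1 \<rho> \<cdot> p1" "Leg2 \<rho> \<cdot> t = Leg2 \<rho> \<cdot> p2"
    using trans by (auto simp: is_transitive_def)
  have dom: "Dom C (Leg2 \<rho>) = Tip \<rho>" "Dom C (Leg1 \<rho>) = Tip \<rho>" using legs by (auto simp: hom_def)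
  then have p: "p1 \<in> hom C P (Tip \<rho>)" "p2 \<in> hom C P (Tip \<rho>)" using P by (auto simp: is_pullback_def)
  obtain x where x: "x \<in> hom C X (Tip \<rho>)" "Leg1 \<rho> \<cdot> x = a" "Leg2 \<rho> \<cdot> x = b"
    using ab by (auto simp: related_def)
  obtain y where y: "y \<in> hom C X (Tip \<rho>)" "Leg1 \<rho> \<cdot> y = b" "Leg2 \<rho> \<cdot> y = c"
    using bc by (auto simp: related_def)
  \<comment> \<open>The two witnesses agree at the middle element \<open>b\<close>, so they form an
    arrow into the pullback on which \<open>t\<close> is defined.\<close>
  obtain u where u: "u \<in> hom C X P" "p1 \<cdot> u = x" "p2 \<cdot> u = y"
    using P x y dom unfolding is_pullback_def by metis
  have "Leg1 \<rho> \<cdot> (t \<cdot> u) = a" "Leg2 \<rho> \<cdot> (t \<cdot> u) = c"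
    using Comp_assoc[OF u(1) t(1) legs(1)] Comp_assoc[OF u(1) t(1) legs(2)]
      Comp_assoc[OF u(1) p(1) legs(1)] Comp_assoc[OF u(1) p(2) legs(2)] t u x y by auto
  then show ?thesis using Comp_closed[OF u(1) t(1)] by (auto simp: related_def)
qed

lemma is_preorder_trans:
  "is_preorder C \<rho> \<Longrightarrow> related C \<rho> X a b \<Longrightarrow> related C \<rho> X b c \<Longrightarrow> related C \<rho> X a c"
  using is_transitive_related by (auto simp: is_preorder_def)

end


section \<open>Generalized elements in exact categories\<close>

context exact_category
begin

section \<open>Binary products and pullbacks from finite limits\<close>

lemma product_exists:
  assumes A: "A \<in> Obj C" and B: "B \<in> Obj C"
  shows "\<exists>P p q. is_product C A B P p q"
proof -
  \<comment> \<open>The discrete category on two objects, each arrow being the identity of the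
    object with the same number.\<close>
  define J :: "(nat, nat) cat" where
    "J = \<lparr>Obj = {0, 1}, Arr = {0, 1}, Dom = id, Cod = id, Ide = id, Comp = \<lambda>g f. f\<rparr>"
  define D where "D = \<lparr>Omap = \<lambda>j. if j = (0::nat) then A else B,
    Amap = \<lambda>j. if j = (0::nat) then Ide C A else Ide C B\<rparr>"
  have "category J"
    by unfold_locales (auto simp: J_def hom_def)
  then have "is_functor J C D"
    using A B category_axioms Ide_closed Comp_Ide[OF Ide_closed]
    by (auto simp: is_functor_def J_def D_def)
  moreover have "finite (Arr J)" by (simp add: J_def)
  ultimately obtain L l where L: "is_limit J C D L l"
    using finite_limits unfolding finitely_complete_def by blast
  have cone: "is_cone J C D X x \<longleftrightarrow> x 0 \<in> hom C X A \<and> x 1 \<in> hom C X B" for X x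
    using Ide_Comp by (auto simp: is_cone_def J_def D_def dest: hom_Obj)
  have "is_product C A B L (l 0) (l 1)"
    unfolding is_product_def
  proof (intro conjI allI ballI)
    show "l 0 \<in> hom C L A" "l 1 \<in> hom C L B" using L cone by (auto simp: is_limit_def)
  next
    fix X x y assume "x \<in> hom C X A" "y \<in> hom C X B"
    then have "is_cone J C D X (\<lambda>j. if j = 0 then x else y)" by (simp add: cone)
    then have "\<exists>!u. u \<in> hom C X L \<and> (\<forall>j \<in> Obj J. l j \<cdot> u = (if j = 0 then x else y))"
      using L unfolding is_limit_def by blast
    then show "\<exists>!u. u \<in> hom C X L \<and> l 0 \<cdot> u = x \<and> l 1 \<cdot> u = y"
      by (simp add: J_def)
  qed
  then show ?thesis by blast
qed

lemma pullback_exists: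
  assumes f: "f \<in> hom C A B" and g: "g \<in> hom C E B"
  shows "\<exists>P p q. is_pullback C f g P p q"
proof -
  \<comment> \<open>The cospan shape: 0, 1 and 2 name objects and their identities, while 3 and 4
    are the arrows from 0 and from 1 to the corner 2. In a composable pair whose first arrow is 3 or
    4 the second is the identity of 2; otherwise the first is an identity.\<close>
  define J :: "(nat, nat) cat" where
    "J = \<lparr>Obj = {0, 1, 2}, Arr = {0, 1, 2, 3, 4},
      Dom = \<lambda>j. if j = 3 then 0 else if j = 4 then 1 else j,
      Cod = \<lambda>j. if j = 3 \<or> j = 4 then 2 else j, Ide = id,
      Comp = \<lambda>v u. if u = 3 \<or> u = 4 then u else v\<rparr>"
  define D where "D = \<lparr>Omap = \<lambda>j. if j = (0::nat) then A else if j = 1 then E else B,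
    Amap = \<lambda>j. if j = (0::nat) then Ide C A else if j = 1 then Ide C E else if j = 2 then Ide C B
      else if j = 3 then f else g\<rparr>"
  note Obj = hom_Obj[OF f] hom_Obj[OF g]
  have "category J"
    by unfold_locales (auto simp: J_def hom_def split: if_splits)
  then have "is_functor J C D"
    using Obj f g category_axioms Ide_closed Comp_Ide[OF Ide_closed] Ide_Comp Comp_Ide
    by (auto simp: is_functor_def J_def D_def split: if_splits)
  moreover have "finite (Arr J)" by (simp add: J_def)
  ultimately obtain L l where L: "is_limit J C D L l"
    using finite_limits unfolding finitely_complete_def by blast
  have cone: "is_cone J C D X x \<longleftrightarrow> x 0 \<in> hom C X A \<and> x 1 \<in> hom C X E \<and> x 2 \<in> hom C X B \<and>
      f \<cdot> x 0 = x 2 \<and> g \<cdot> x 1 = x 2" for X x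
    using Ide_Comp by (auto simp: is_cone_def J_def D_def dest: hom_Obj)
  have l: "l 0 \<in> hom C L A" "l 1 \<in> hom C L E" "l 2 \<in> hom C L B" "f \<cdot> l 0 = l 2" "g \<cdot> l 1 = l 2"
    using L cone by (auto simp: is_limit_def)
  have univ: "\<exists>!u. u \<in> hom C X L \<and> l 0 \<cdot> u = x \<and> l 1 \<cdot> u = y"
    if xy: "x \<in> hom C X A" "y \<in> hom C X E" "f \<cdot> x = g \<cdot> y" for X x y
  proof -
    let ?x = "\<lambda>j::nat. if j = 0 then x else if j = 1 then y else f \<cdot> x"
    have "is_cone J C D X ?x" using xy Comp_closed[OF xy(1) f] by (simp add: cone)
    then have "\<exists>!u. u \<in> hom C X L \<and> (\<forall>j \<in> Obj J. l j \<cdot> u = ?x j)"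
      using L unfolding is_limit_def by blast
    \<comment> \<open>The equation at the corner follows from the one at 0, since \<open>l 2\<close>
      is \<open>f \<cdot> l 0\<close>.\<close>
    moreover have "(\<forall>j \<in> Obj J. l j \<cdot> u = ?x j) \<longleftrightarrow> l 0 \<cdot> u = x \<and> l 1 \<cdot> u = y"
      if "u \<in> hom C X L" for u
      using l Comp_assoc[OF that l(1) f] by (auto simp: J_def)
    ultimately show ?thesis by (smt (verit))
  qed
  have "is_pullback C f g L (l 0) (l 1)"
    using f g l univ by (auto simp: is_pullback_def hom_def)
  then show ?thesis by blast
qed

section \<open>Building relations from generalized elements\<close>

lemma is_relationI:
  assumes legs: "Leg1 \<rho> \<in> hom C (Tip \<rho>) (Base \<rho>)" "Leg2 \<rho> \<in> hom C (Tip \<rho>) (Base \<rho>)"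
    and monic: "\<And>X u v. u \<in> hom C X (Tip \<rho>) \<Longrightarrow> v \<in> hom C X (Tip \<rho>) \<Longrightarrow>
      Leg1 \<rho> \<cdot> u = Leg1 \<rho> \<cdot> v \<Longrightarrow> Leg2 \<rho> \<cdot> u = Leg2 \<rho> \<cdot> v \<Longrightarrow> u = v"
  shows "is_relation C \<rho>"
proof -
  obtain P p q where P: "is_product C (Base \<rho>) (Base \<rho>) P p q"
    using product_exists hom_Obj[OF legs(1)] by blast
  then have pq: "p \<in> hom C P (Base \<rho>)" "q \<in> hom C P (Base \<rho>)" by (auto simp: is_product_def)
  \<comment> \<open>The pairing of the legs; it is monic because arrows that it identifies are
    identified by both legs.\<close>
  obtain m where m: "m \<in> hom C (Tip \<rho>) P" "p \<cdot> m = Leg1 \<rho>" "q \<cdot> m = Leg2 \<rho>"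
    using P legs unfolding is_product_def by metis
  have "u = v" if "u \<in> hom C X (Tip \<rho>)" "v \<in> hom C X (Tip \<rho>)" "m \<cdot> u = m \<cdot> v" for X u v
    using monic[OF that(1,2)] Comp_assoc[OF that(1) m(1)] Comp_assoc[OF that(2) m(1)] pq that(3) m
    by metis
  then have "is_mono C m" using m(1) by (auto simp: is_mono_def hom_def)
  then show ?thesis using P m legs unfolding is_relation_def by blast
qed

text \<open>The pullback carries the generic composable pair of related pairs; applying
  \<open>trans\<close> at that stage yields the required arrow into the tip.\<close>

lemma is_transitiveI:
  assumes rel: "is_relation C \<rho>"
    and trans: "\<And>X a b c. related C \<rho> X a b \<Longrightarrow> related C \<rho> X b c \<Longrightarrow> related C \<rho> X a c"
  shows "is_transitive C \<rho>"
proof -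
  note legs = is_relation_legs[OF rel]
  obtain P p1 p2 where P: "is_pullback C (Leg2 \<rho>) (Leg1 \<rho>) P p1 p2"
    using pullback_exists[OF legs(2,1)] by blast
  then have p: "p1 \<in> hom C P (Tip \<rho>)" "p2 \<in> hom C P (Tip \<rho>)" "Leg2 \<rho> \<cdot> p1 = Leg1 \<rho> \<cdot> p2"
    using legs by (auto simp: is_pullback_def hom_def)
  have "related C \<rho> P (Leg1 \<rho> \<cdot> p1) (Leg2 \<rho> \<cdot> p1)" "related C \<rho> P (Leg2 \<rho> \<cdot> p1) (Leg2 \<rho> \<cdot> p2)"
    using p by (auto simp: related_def)
  then have "related C \<rho> P (Leg1 \<rho> \<cdot> p1) (Leg2 \<rho> \<cdot> p2)" by (rule trans)
  then show ?thesis using P unfolding is_transitive_def related_def by blast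
qed

lemma is_relation_diag: "A \<in> Obj C \<Longrightarrow> is_relation C (diag_rel C A)"
  by (rule is_relationI) (auto simp: diag_rel_def Ide_closed Ide_Comp)

lemma related_diag:
  "related C (diag_rel C A) X a b \<longleftrightarrow> a \<in> hom C X A \<and> a = b"
  by (auto simp: related_def diag_rel_def Ide_Comp)

lemma is_preorder_diag: "A \<in> Obj C \<Longrightarrow> is_preorder C (diag_rel C A)"
  unfolding is_preorder_def is_reflexive_def rel_le_iff_related
  by (auto intro!: is_transitiveI is_relation_diag simp: related_diag)
    (auto simp: diag_rel_def Ide_closed)

text \<open>Elements of \<open>Q\<close> have representatives in \<open>A\<close> only locally:
  pulling \<open>q\<close> back along \<open>x\<close> provides one on a cover of \<open>X\<close>,
  and the cover is a regular epimorphism by stability.\<close>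

lemma regular_epi_lift:
  assumes q: "is_regular_epi C q" "q \<in> hom C A Q" and x: "x \<in> hom C X Q"
  shows "\<exists>Y e a. is_regular_epi C e \<and> e \<in> hom C Y X \<and> a \<in> hom C Y A \<and> q \<cdot> a = x \<cdot> e"
proof -
  obtain Y a e where P: "is_pullback C q x Y a e" using pullback_exists[OF q(2) x] by blast
  moreover have "is_regular_epi C e" using regular_epi_stable q(1) P by blast
  ultimately show ?thesis
    using q(2) x by (intro exI[of _ Y] exI[of _ e] exI[of _ a]) (auto simp: is_pullback_def hom_def)
qed

text \<open>The meet of the relation with its opposite is the pullback of the pairings
  \<open><r1, r2>\<close> and \<open><r2, r1>\<close> into the product. It is described here on
  generalized elements.\<close>

lemma symmetric_part:
  assumes rel: "is_relation C \<rho>"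
  shows "\<exists>\<mu>. is_relation C \<mu> \<and> Base \<mu> = Base \<rho> \<and>
    (\<forall>X a b. related C \<mu> X a b \<longleftrightarrow> related C \<rho> X a b \<and> related C \<rho> X b a)"
proof -
  note legs = is_relation_legs[OF rel]
  obtain P p q where P: "is_product C (Base \<rho>) (Base \<rho>) P p q"
    using product_exists hom_Obj[OF legs(1)] by blast
  then have pq: "p \<in> hom C P (Base \<rho>)" "q \<in> hom C P (Base \<rho>)" by (auto simp: is_product_def)
  have P_ext: "u = v" if uv: "u \<in> hom C X P" "v \<in> hom C X P" "p \<cdot> u = p \<cdot> v" "q \<cdot> u = q \<cdot> v" for X u v
    using P uv Comp_closed[OF uv(1) pq(1)] Comp_closed[OF uv(1) pq(2)]
    unfolding is_product_def by metis
  obtain m where m: "m \<in> hom C (Tip \<rho>) P" "p \<cdot> m = Leg1 \<rho>" "q \<cdot> m = Leg2 \<rho>"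
    using P legs unfolding is_product_def by metis
  obtain n where n: "n \<in> hom C (Tip \<rho>) P" "p \<cdot> n = Leg2 \<rho>" "q \<cdot> n = Leg1 \<rho>"
    using P legs unfolding is_product_def by metis
  obtain M u v where M: "is_pullback C m n M u v" using pullback_exists[OF m(1) n(1)] by blast
  then have uv: "u \<in> hom C M (Tip \<rho>)" "v \<in> hom C M (Tip \<rho>)" "m \<cdot> u = n \<cdot> v"
    using m n by (auto simp: is_pullback_def hom_def)
  have univ: "\<exists>!w. w \<in> hom C X M \<and> u \<cdot> w = x \<and> v \<cdot> w = y"
    if "x \<in> hom C X (Tip \<rho>)" "y \<in> hom C X (Tip \<rho>)" "m \<cdot> x = n \<cdot> y" for X x y
  proof -
    have "Dom C m = Tip \<rho>" "Dom C n = Tip \<rho>" using m n by (auto simp: hom_def)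
    then show ?thesis using M that unfolding is_pullback_def by metis
  qed
  \<comment> \<open>The two projections of the pullback witness the same pair, read in opposite
    directions.\<close>
  have swap: "Leg1 \<rho> \<cdot> u = Leg2 \<rho> \<cdot> v" "Leg2 \<rho> \<cdot> u = Leg1 \<rho> \<cdot> v"
    using Comp_assoc[OF uv(1) m(1) pq(1)] Comp_assoc[OF uv(1) m(1) pq(2)]
      Comp_assoc[OF uv(2) n(1) pq(1)] Comp_assoc[OF uv(2) n(1) pq(2)] uv(3) m n by auto
  define \<mu> where "\<mu> = \<lparr>Base = Base \<rho>, Tip = M, Leg1 = Leg1 \<rho> \<cdot> u, Leg2 = Leg2 \<rho> \<cdot> u\<rparr>"
  have \<mu>legs: "Leg1 \<rho> \<cdot> u \<in> hom C M (Base \<rho>)" "Leg2 \<rho> \<cdot> u \<in> hom C M (Base \<rho>)"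
    using Comp_closed[OF uv(1)] legs by auto
  have "is_relation C \<mu>"
  proof (rule is_relationI)
    fix X x y
    assume x: "x \<in> hom C X (Tip \<mu>)" and y: "y \<in> hom C X (Tip \<mu>)"
      and eq: "Leg1 \<mu> \<cdot> x = Leg1 \<mu> \<cdot> y" "Leg2 \<mu> \<cdot> x = Leg2 \<mu> \<cdot> y"
    then have x: "x \<in> hom C X M" and y: "y \<in> hom C X M"
      and eq: "(Leg1 \<rho> \<cdot> u) \<cdot> x = (Leg1 \<rho> \<cdot> u) \<cdot> y" "(Leg2 \<rho> \<cdot> u) \<cdot> x = (Leg2 \<rho> \<cdot> u) \<cdot> y"
      by (auto simp: \<mu>_def)
    note cl = Comp_closed[OF x uv(1)] Comp_closed[OF y uv(1)] Comp_closed[OF x uv(2)]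
      Comp_closed[OF y uv(2)]
    \<comment> \<open>By \<open>swap\<close> the legs of \<open>\<mu>\<close> can be read through
      \<open>u\<close> or through \<open>v\<close>, so joint monicity of \<open>\<rho>\<close>
      handles both projections; uniqueness for the pullback then finishes.\<close>
    have "u \<cdot> x = u \<cdot> y"
      using is_relation_jointly_monic[OF rel cl(1,2)] eq Comp_assoc[OF x uv(1)]
        Comp_assoc[OF y uv(1)] legs by auto
    moreover have "v \<cdot> x = v \<cdot> y"
      using is_relation_jointly_monic[OF rel cl(3,4)] eq swap Comp_assoc[OF x uv(2)]
        Comp_assoc[OF y uv(2)] legs by auto
    moreover have "m \<cdot> (u \<cdot> x) = n \<cdot> (v \<cdot> x)"
      using Comp_assoc[OF x uv(1) m(1)] Comp_assoc[OF x uv(2) n(1)] uv(3) by simp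
    ultimately show "x = y" using univ[OF cl(1,3)] x y by metis
  qed (use \<mu>legs in \<open>auto simp: \<mu>_def\<close>)
  moreover have "related C \<mu> X a b \<longleftrightarrow> related C \<rho> X a b \<and> related C \<rho> X b a" for X a b
  proof
    assume "related C \<mu> X a b"
    then obtain w where w: "w \<in> hom C X M" "(Leg1 \<rho> \<cdot> u) \<cdot> w = a" "(Leg2 \<rho> \<cdot> u) \<cdot> w = b"
      by (auto simp: related_def \<mu>_def)
    have "Leg1 \<rho> \<cdot> (u \<cdot> w) = a" "Leg2 \<rho> \<cdot> (u \<cdot> w) = b"
      "Leg1 \<rho> \<cdot> (v \<cdot> w) = b" "Leg2 \<rho> \<cdot> (v \<cdot> w) = a"
      using w swap Comp_assoc[OF w(1) uv(1) legs(1)] Comp_assoc[OF w(1) uv(1) legs(2)]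
        Comp_assoc[OF w(1) uv(2) legs(1)] Comp_assoc[OF w(1) uv(2) legs(2)] by metis+
    then show "related C \<rho> X a b \<and> related C \<rho> X b a"
      using Comp_closed[OF w(1) uv(1)] Comp_closed[OF w(1) uv(2)] unfolding related_def by blast
  next
    assume "related C \<rho> X a b \<and> related C \<rho> X b a"
    then obtain x y where x: "x \<in> hom C X (Tip \<rho>)" "Leg1 \<rho> \<cdot> x = a" "Leg2 \<rho> \<cdot> x = b"
      and y: "y \<in> hom C X (Tip \<rho>)" "Leg1 \<rho> \<cdot> y = b" "Leg2 \<rho> \<cdot> y = a"
      unfolding related_def by blast
    have "m \<cdot> x = n \<cdot> y"
      using P_ext[OF Comp_closed[OF x(1) m(1)] Comp_closed[OF y(1) n(1)]]
        Comp_assoc[OF x(1) m(1)] Comp_assoc[OF y(1) n(1)] pq m n x y by metis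
    then obtain w where w: "w \<in> hom C X M" "u \<cdot> w = x" using univ x(1) y(1) by metis
    then show "related C \<mu> X a b"
      using Comp_assoc[OF w(1) uv(1)] legs x by (auto simp: related_def \<mu>_def)
  qed
  ultimately show ?thesis by (intro exI[of _ \<mu>]) (auto simp: \<mu>_def)
qed

lemma related_opp: "related C (opp_rel \<rho>) X a b \<longleftrightarrow> related C \<rho> X b a"
  by (auto simp: related_def opp_rel_def)

text \<open>The meet \<open>\<mu>\<close> in the definition is known only through comparison with
  other relations. The elementwise meet \<open>\<nu>\<close> lies below it, and \<open>\<mu>\<close>
  lies below the diagonal, so a pair related both ways is diagonal.\<close>

lemma is_partial_order_antisym:
  assumes po: "is_partial_order C \<rho>" and ab: "related C \<rho> X a b" "related C \<rho> X b a"
  shows "a = b"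
proof -
  have rel: "is_relation C \<rho>" using po by (simp add: is_partial_order_def is_preorder_def)
  obtain \<mu> where meet: "is_rel_meet C \<rho> (opp_rel \<rho>) \<mu>" and le: "rel_le C \<mu> (diag_rel C (Base \<rho>))"
    using po by (auto simp: is_partial_order_def rel_eq_def)
  obtain \<nu> where \<nu>: "is_relation C \<nu>" "Base \<nu> = Base \<rho>"
    "\<And>X a b. related C \<nu> X a b \<longleftrightarrow> related C \<rho> X a b \<and> related C \<rho> X b a"
    using symmetric_part[OF rel] by blast
  have \<mu>: "is_relation C \<mu>" using meet by (simp add: is_rel_meet_def)
  have "rel_le C \<nu> \<rho>" "rel_le C \<nu> (opp_rel \<rho>)"
    using related_tip[OF \<nu>(1)] \<nu>
    by (auto simp: rel_le_iff_related related_opp) (simp add: opp_rel_def)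
  then have "rel_le C \<nu> \<mu>" using meet \<nu>(1) by (simp add: is_rel_meet_def)
  then have "related C \<mu> X a b"
    using related_mono \<nu> ab is_relation_legs[OF \<mu>] by blast
  moreover have "Base \<rho> \<in> Obj C" using hom_Obj is_relation_legs[OF rel] by blast
  ultimately have "related C (diag_rel C (Base \<rho>)) X a b"
    using related_mono[OF le] is_relation_legs[OF is_relation_diag] by blast
  then show ?thesis by (simp add: related_diag)
qed

text \<open>The diagonal itself serves as the meet: reflexivity puts it below \<open>\<rho>\<close>
  and its opposite, and antisymmetry at the generic pair of \<open>\<nu>\<close> puts any common
  lower bound below the diagonal.\<close>

lemma is_partial_orderI:
  assumes pre: "is_preorder C \<rho>"
    and antisym: "\<And>X a b. related C \<rho> X a b \<Longrightarrow> related C \<rho> X b a \<Longrightarrow> a = b"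
  shows "is_partial_order C \<rho>"
proof -
  have rel: "is_relation C \<rho>" using pre by (simp add: is_preorder_def)
  note legs = is_relation_legs[OF rel]
  let ?\<Delta> = "diag_rel C (Base \<rho>)"
  have B: "Base \<rho> \<in> Obj C" using hom_Obj legs by blast
  have le: "rel_le C ?\<Delta> \<rho>" using pre by (simp add: is_preorder_def is_reflexive_def)
  then have le_opp: "rel_le C ?\<Delta> (opp_rel \<rho>)"
    by (auto simp: rel_le_def diag_rel_def opp_rel_def)
  have "rel_le C \<nu> ?\<Delta>" if "is_relation C \<nu>" "rel_le C \<nu> \<rho>" "rel_le C \<nu> (opp_rel \<rho>)" for \<nu>
    using that antisym is_relation_legs(1)[OF that(1)]
    by (auto simp: rel_le_iff_related related_diag related_opp) (auto simp: diag_rel_def)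
  then have "is_rel_meet C \<rho> (opp_rel \<rho>) ?\<Delta>"
    using le le_opp is_relation_diag[OF B] by (auto simp: is_rel_meet_def)
  moreover have "rel_eq C ?\<Delta> ?\<Delta>"
    using related_tip[OF is_relation_diag[OF B]] by (simp add: rel_eq_def rel_le_iff_related)
  ultimately show ?thesis using pre by (auto simp: is_partial_order_def)
qed

section \<open>Image factorizations and quotients\<close>

lemma is_mono_unique:
  "is_mono C m \<Longrightarrow> m \<in> hom C A B \<Longrightarrow> u \<in> hom C X A \<Longrightarrow> v \<in> hom C X A \<Longrightarrow> m \<cdot> u = m \<cdot> v \<Longrightarrow> u = v"
  by (auto simp: is_mono_def hom_def)

lemma factorization_hom:
  assumes f: "f \<in> hom C A B"
  shows "\<exists>Q e m. is_regular_epi C e \<and> e \<in> hom C A Q \<and> is_mono C m \<and> m \<in> hom C Q B \<and> m \<cdot> e = f"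
proof -
  obtain m e where me: "is_regular_epi C e" "is_mono C m" "Cod C e = Dom C m" "f = m \<cdot> e"
    using factorization[of f] f by (auto simp: hom_def)
  have e: "e \<in> hom C (Dom C e) (Dom C m)" and m: "m \<in> hom C (Dom C m) (Cod C m)"
    using me is_regular_epi_Arr[OF me(1)] by (auto simp: hom_def is_mono_def)
  have "Dom C e = A" "Cod C m = B" using Comp_closed[OF e m] f me(4) by (auto simp: hom_def)
  then show ?thesis using me e m by blast
qed

text \<open>Effectiveness yields an arrow \<open>f\<close> with kernel pair \<open>\<mu>\<close>.
  Its regular epi part identifies the same elements as \<open>f\<close>, since the mono part
  identifies nothing further.\<close>

lemma equivalence_rel_quotient:
  assumes eq: "is_equivalence_rel C \<mu>"
  shows "\<exists>Q q. is_regular_epi C q \<and> q \<in> hom C (Base \<mu>) Q \<and>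
    (\<forall>X. \<forall>a \<in> hom C X (Base \<mu>). \<forall>b \<in> hom C X (Base \<mu>). q \<cdot> a = q \<cdot> b \<longleftrightarrow> related C \<mu> X a b)"
proof -
  have rel: "is_relation C \<mu>" using eq by (simp add: is_equivalence_rel_def)
  obtain f where "is_kernel_pair C f \<mu>" using effective[OF eq] by blast
  then obtain B where f: "f \<in> hom C (Base \<mu>) B"
    and P: "is_pullback C f f (Tip \<mu>) (Leg1 \<mu>) (Leg2 \<mu>)"
    by (auto simp: is_kernel_pair_def hom_def)
  obtain Q q m where q: "is_regular_epi C q" "q \<in> hom C (Base \<mu>) Q"
    and m: "is_mono C m" "m \<in> hom C Q B" and mq: "m \<cdot> q = f"
    using factorization_hom[OF f] by blast
  have "q \<cdot> a = q \<cdot> b \<longleftrightarrow> related C \<mu> X a b"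
    if a: "a \<in> hom C X (Base \<mu>)" and b: "b \<in> hom C X (Base \<mu>)" for X a b
  proof -
    have "q \<cdot> a = q \<cdot> b \<longleftrightarrow> f \<cdot> a = f \<cdot> b"
      using Comp_assoc[OF a q(2) m(2)] Comp_assoc[OF b q(2) m(2)] mq
        is_mono_unique[OF m Comp_closed[OF a q(2)] Comp_closed[OF b q(2)]] by auto
    also have "\<dots> \<longleftrightarrow> related C \<mu> X a b"
    proof
      assume "f \<cdot> a = f \<cdot> b"
      then show "related C \<mu> X a b"
        using P a b f unfolding is_pullback_def hom_def related_def
        by (smt (verit) mem_Collect_eq)
    next
      assume "related C \<mu> X a b"
      then obtain h where h: "h \<in> hom C X (Tip \<mu>)" "Leg1 \<mu> \<cdot> h = a" "Leg2 \<mu> \<cdot> h = b"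
        by (auto simp: related_def)
      then show "f \<cdot> a = f \<cdot> b"
        using Comp_assoc[OF h(1) is_relation_legs(1)[OF rel] f]
          Comp_assoc[OF h(1) is_relation_legs(2)[OF rel] f] P by (auto simp: is_pullback_def)
    qed
    finally show ?thesis .
  qed
  then show ?thesis using q by blast
qed

text \<open>Factor the pairing of \<open>f\<close> and \<open>g\<close> into the product: the mono
  part is the relation, the regular epi part is \<open>e\<close>. Applied to the legs of a relation
  composed with \<open>q\<close>, this is its image along \<open>q \<times> q\<close>.\<close>

lemma image_relation:
  assumes f: "f \<in> hom C R B" and g: "g \<in> hom C R B"
  shows "\<exists>\<sigma> e. is_relation C \<sigma> \<and> Base \<sigma> = B \<and> is_regular_epi C e \<and> e \<in> hom C R (Tip \<sigma>) \<and>
    Leg1 \<sigma> \<cdot> e = f \<and> Leg2 \<sigma> \<cdot> e = g"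
proof -
  obtain P p q where P: "is_product C B B P p q" using product_exists hom_Obj[OF f] by blast
  then have pq: "p \<in> hom C P B" "q \<in> hom C P B" by (auto simp: is_product_def)
  obtain h where h: "h \<in> hom C R P" "p \<cdot> h = f" "q \<cdot> h = g"
    using P f g unfolding is_product_def by metis
  obtain S e m where e: "is_regular_epi C e" "e \<in> hom C R S"
    and m: "is_mono C m" "m \<in> hom C S P" "m \<cdot> e = h"
    using factorization_hom[OF h(1)] by blast
  define \<sigma> where "\<sigma> = \<lparr>Base = B, Tip = S, Leg1 = p \<cdot> m, Leg2 = q \<cdot> m\<rparr>"
  have "is_relation C \<sigma>"
    unfolding is_relation_def \<sigma>_def using P m Comp_closed[OF m(2)] pq by auto
  then show ?thesis
    using e h m Comp_assoc[OF e(2) m(2)] pq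
    by (intro exI[of _ \<sigma>] exI[of _ e]) (auto simp: \<sigma>_def)
qed

text \<open>
  The projection \<open>q\<close> onto the quotient by \<open>\<rho> \<and> \<rho>\<^sup>o\<close> also reflects the order, so every
  order-theoretic property of the image of \<open>\<rho>\<close> may be checked on lifts to \<open>A\<close> along a regular
  epimorphism.
\<close>

lemma partial_order_quotient:
  assumes pre: "is_preorder C \<rho>"
  shows "\<exists>\<sigma> q e. is_partial_order C \<sigma> \<and>
    is_regular_epi C q \<and> q \<in> hom C (Base \<rho>) (Base \<sigma>) \<and>
    is_regular_epi C e \<and> e \<in> hom C (Tip \<rho>) (Tip \<sigma>) \<and>
    Leg1 \<sigma> \<cdot> e = q \<cdot> Leg1 \<rho> \<and> Leg2 \<sigma> \<cdot> e = q \<cdot> Leg2 \<rho> \<and>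
    (\<forall>X. \<forall>a \<in> hom C X (Base \<rho>). \<forall>b \<in> hom C X (Base \<rho>).
       q \<cdot> a = q \<cdot> b \<longleftrightarrow> related C \<rho> X a b \<and> related C \<rho> X b a)"
proof -
  have rel: "is_relation C \<rho>" using pre by (simp add: is_preorder_def)
  note legs = is_relation_legs[OF rel] and trans = is_preorder_trans[OF pre]
  obtain \<mu> where \<mu>: "is_relation C \<mu>" "Base \<mu> = Base \<rho>"
    "\<And>X a b. related C \<mu> X a b \<longleftrightarrow> related C \<rho> X a b \<and> related C \<rho> X b a"
    using symmetric_part[OF rel] by blast
  have B: "Base \<rho> \<in> Obj C" using hom_Obj legs by blast
  have "is_equivalence_rel C \<mu>"
    unfolding is_equivalence_rel_def
  proof (intro conjI)
    show "is_reflexive C \<mu>"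
      using \<mu> is_preorder_refl[OF pre Ide_closed[OF B]]
      by (simp add: is_reflexive_def rel_le_iff_related diag_rel_def)
    show "is_symmetric C \<mu>"
      using \<mu> related_tip[OF \<mu>(1)]
      by (auto simp: is_symmetric_def rel_le_iff_related opp_rel_def)
    show "is_transitive C \<mu>"
      using \<mu> trans by (intro is_transitiveI) blast+
  qed (rule \<mu>)
  from equivalence_rel_quotient[OF this]
  obtain Q q where q: "is_regular_epi C q" "q \<in> hom C (Base \<rho>) Q"
    and ker: "\<And>X a b. a \<in> hom C X (Base \<rho>) \<Longrightarrow> b \<in> hom C X (Base \<rho>) \<Longrightarrow>
      q \<cdot> a = q \<cdot> b \<longleftrightarrow> related C \<rho> X a b \<and> related C \<rho> X b a"
    using \<mu> by auto
  obtain \<sigma> e where \<sigma>: "is_relation C \<sigma>" "Base \<sigma> = Q"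
    and e: "is_regular_epi C e" "e \<in> hom C (Tip \<rho>) (Tip \<sigma>)"
      "Leg1 \<sigma> \<cdot> e = q \<cdot> Leg1 \<rho>" "Leg2 \<sigma> \<cdot> e = q \<cdot> Leg2 \<rho>"
    using image_relation[OF Comp_closed[OF legs(1) q(2)] Comp_closed[OF legs(2) q(2)]] by blast
  note \<sigma>legs = is_relation_legs[OF \<sigma>(1), unfolded \<sigma>(2)]
  have \<sigma>hom: "a \<in> hom C X Q" "b \<in> hom C X Q" if "related C \<sigma> X a b" for X a b
    using that Comp_closed \<sigma>legs by (auto simp: related_def)
  have preserve: "related C \<sigma> X (q \<cdot> a) (q \<cdot> b)" if ab: "related C \<rho> X a b" for X a b
  proof -
    obtain h where h: "h \<in> hom C X (Tip \<rho>)" "Leg1 \<rho> \<cdot> h = a" "Leg2 \<rho> \<cdot> h = b"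
      using ab by (auto simp: related_def)
    have "Leg1 \<sigma> \<cdot> (e \<cdot> h) = q \<cdot> a" "Leg2 \<sigma> \<cdot> (e \<cdot> h) = q \<cdot> b"
      using Comp_assoc[OF h(1) e(2) \<sigma>legs(1)] Comp_assoc[OF h(1) e(2) \<sigma>legs(2)]
        Comp_assoc[OF h(1) legs(1) q(2)] Comp_assoc[OF h(1) legs(2) q(2)] e h by auto
    then show ?thesis using Comp_closed[OF h(1) e(2)] by (auto simp: related_def)
  qed
  have reflect: "related C \<rho> X a b"
    if a: "a \<in> hom C X (Base \<rho>)" and b: "b \<in> hom C X (Base \<rho>)"
      and ab: "related C \<sigma> X (q \<cdot> a) (q \<cdot> b)" for X a b
  proof -
    obtain t where t: "t \<in> hom C X (Tip \<sigma>)" "Leg1 \<sigma> \<cdot> t = q \<cdot> a" "Leg2 \<sigma> \<cdot> t = q \<cdot> b"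
      using ab by (auto simp: related_def)
    \<comment> \<open>The witness \<open>t\<close> lifts locally along \<open>e\<close> to a pair
      related by \<open>\<rho>\<close>. Its components have the same image under \<open>q\<close> as
      the restrictions of \<open>a\<close> and \<open>b\<close>, so they are related to them both
      ways; transitivity gives the claim on the cover and \<open>related_local\<close> removes the
      cover.\<close>
    obtain Y c r where c: "is_regular_epi C c" "c \<in> hom C Y X" and r: "r \<in> hom C Y (Tip \<rho>)"
      and er: "e \<cdot> r = t \<cdot> c"
      using regular_epi_lift[OF e(1,2) t(1)] by blast
    note ac = Comp_closed[OF c(2) a] and bc = Comp_closed[OF c(2) b]
    have "q \<cdot> (Leg1 \<rho> \<cdot> r) = q \<cdot> (a \<cdot> c)" "q \<cdot> (Leg2 \<rho> \<cdot> r) = q \<cdot> (b \<cdot> c)"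
      using Comp_assoc[OF r legs(1) q(2)] Comp_assoc[OF r e(2) \<sigma>legs(1)]
        Comp_assoc[OF c(2) t(1) \<sigma>legs(1)] Comp_assoc[OF c(2) a q(2)]
        Comp_assoc[OF r legs(2) q(2)] Comp_assoc[OF r e(2) \<sigma>legs(2)]
        Comp_assoc[OF c(2) t(1) \<sigma>legs(2)] Comp_assoc[OF c(2) b q(2)] e(3,4) t(2,3) er by auto
    then have "related C \<rho> Y (a \<cdot> c) (Leg1 \<rho> \<cdot> r)" "related C \<rho> Y (Leg2 \<rho> \<cdot> r) (b \<cdot> c)"
      using ker[OF Comp_closed[OF r legs(1)] ac] ker[OF Comp_closed[OF r legs(2)] bc] by auto
    moreover have "related C \<rho> Y (Leg1 \<rho> \<cdot> r) (Leg2 \<rho> \<cdot> r)" using r by (auto simp: related_def)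
    ultimately have "related C \<rho> Y (a \<cdot> c) (b \<cdot> c)" using trans by blast
    then show ?thesis by (rule related_local[OF c rel a b])
  qed
  have lift: "\<exists>Y c a. is_regular_epi C c \<and> c \<in> hom C Y X \<and> a \<in> hom C Y (Base \<rho>) \<and> q \<cdot> a = x \<cdot> c"
    if "x \<in> hom C X Q" for x X
    using regular_epi_lift[OF q that] .
  have comp: "related C \<sigma> Y (x \<cdot> c) (y \<cdot> c)"
    if "related C \<sigma> X x y" "c \<in> hom C Y X" for X Y x y c
    using related_comp that is_relation_legs[OF \<sigma>(1)] by blast
  have \<sigma>_trans: "related C \<sigma> X x z" if xyz: "related C \<sigma> X x y" "related C \<sigma> X y z" for X x y z
  proof -
    \<comment> \<open>Transitivity is first shown for elements in the image of \<open>q\<close>,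
      where it comes from \<open>\<rho>\<close>. The middle, right and left elements are then made
      arbitrary one at a time, each by passing to a cover with a representative and
      descending.\<close>
    have step1: "related C \<sigma> X (q \<cdot> a) (q \<cdot> c)"
      if "a \<in> hom C X (Base \<rho>)" "b \<in> hom C X (Base \<rho>)" "c \<in> hom C X (Base \<rho>)"
        "related C \<sigma> X (q \<cdot> a) (q \<cdot> b)" "related C \<sigma> X (q \<cdot> b) (q \<cdot> c)" for X a b c
      using that reflect preserve trans by blast
    have step2: "related C \<sigma> X (q \<cdot> a) (q \<cdot> c)"
      if a: "a \<in> hom C X (Base \<rho>)" and c: "c \<in> hom C X (Base \<rho>)"
        and xy: "related C \<sigma> X (q \<cdot> a) y" "related C \<sigma> X y (q \<cdot> c)" for X a y c
    proof -
      obtain Y d b where d: "is_regular_epi C d" "d \<in> hom C Y X" and b: "b \<in> hom C Y (Base \<rho>)"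
        "q \<cdot> b = y \<cdot> d" using lift[OF \<sigma>hom(1)[OF xy(2)]] by blast
      have "related C \<sigma> Y (q \<cdot> (a \<cdot> d)) (q \<cdot> (c \<cdot> d))"
        using step1[OF Comp_closed[OF d(2) a] b(1) Comp_closed[OF d(2) c]]
          comp[OF xy(1) d(2)] comp[OF xy(2) d(2)] b(2)
          Comp_assoc[OF d(2) a q(2)] Comp_assoc[OF d(2) c q(2)] by simp
      then have "related C \<sigma> Y ((q \<cdot> a) \<cdot> d) ((q \<cdot> c) \<cdot> d)"
        using Comp_assoc[OF d(2) a q(2)] Comp_assoc[OF d(2) c q(2)] by simp
      then show ?thesis
        using related_local[OF d \<sigma>(1)] Comp_closed[OF a q(2)] Comp_closed[OF c q(2)] \<sigma>(2) by blast
    qed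
    have step3: "related C \<sigma> X (q \<cdot> a) z"
      if a: "a \<in> hom C X (Base \<rho>)"
        and xy: "related C \<sigma> X (q \<cdot> a) y" "related C \<sigma> X y z" for X a y z
    proof -
      obtain Y d c where d: "is_regular_epi C d" "d \<in> hom C Y X" and c: "c \<in> hom C Y (Base \<rho>)"
        "q \<cdot> c = z \<cdot> d" using lift[OF \<sigma>hom(2)[OF xy(2)]] by blast
      have "related C \<sigma> Y (q \<cdot> (a \<cdot> d)) (q \<cdot> c)"
        using step2[OF Comp_closed[OF d(2) a] c(1), of "y \<cdot> d"]
          comp[OF xy(1) d(2)] comp[OF xy(2) d(2)] c(2) Comp_assoc[OF d(2) a q(2)] by simp
      then have "related C \<sigma> Y ((q \<cdot> a) \<cdot> d) (z \<cdot> d)"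
        using Comp_assoc[OF d(2) a q(2)] c(2) by simp
      then show ?thesis
        using related_local[OF d \<sigma>(1)] Comp_closed[OF a q(2)] \<sigma>hom[OF xy(2)] \<sigma>(2) by blast
    qed
    obtain Y d a where d: "is_regular_epi C d" "d \<in> hom C Y X" and a: "a \<in> hom C Y (Base \<rho>)"
      "q \<cdot> a = x \<cdot> d" using lift[OF \<sigma>hom(1)[OF xyz(1)]] by blast
    have "related C \<sigma> Y (x \<cdot> d) (z \<cdot> d)"
      using step3[OF a(1)] comp[OF xyz(1) d(2)] comp[OF xyz(2) d(2)] a(2) by simp
    then show ?thesis
      using related_local[OF d \<sigma>(1)] \<sigma>hom[OF xyz(1)] \<sigma>hom[OF xyz(2)] \<sigma>(2) by blast
  qed
  have \<sigma>_antisym: "x = y" if xy: "related C \<sigma> X x y" "related C \<sigma> X y x" for X x y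
  proof -
    have step: "q \<cdot> a = y" if a: "a \<in> hom C X (Base \<rho>)"
      and xy: "related C \<sigma> X (q \<cdot> a) y" "related C \<sigma> X y (q \<cdot> a)" for X a y
    proof -
      obtain Y d b where d: "is_regular_epi C d" "d \<in> hom C Y X" and b: "b \<in> hom C Y (Base \<rho>)"
        "q \<cdot> b = y \<cdot> d" using lift[OF \<sigma>hom(1)[OF xy(2)]] by blast
      note ad = Comp_closed[OF d(2) a]
      \<comment> \<open>Representatives of two mutually related elements of the quotient are related
        both ways by \<open>\<rho>\<close>, hence identified by \<open>q\<close>.\<close>
      have "related C \<rho> Y (a \<cdot> d) b \<and> related C \<rho> Y b (a \<cdot> d)"
        using reflect[OF ad b(1)] reflect[OF b(1) ad] comp[OF xy(1) d(2)] comp[OF xy(2) d(2)]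
          b(2) Comp_assoc[OF d(2) a q(2)] by simp
      then have "(q \<cdot> a) \<cdot> d = y \<cdot> d"
        using ker[OF ad b(1)] b(2) Comp_assoc[OF d(2) a q(2)] by simp
      then show ?thesis
        using is_regular_epi_epi[OF d Comp_closed[OF a q(2)] \<sigma>hom(1)[OF xy(2)]] by blast
    qed
    obtain Y d a where d: "is_regular_epi C d" "d \<in> hom C Y X" and a: "a \<in> hom C Y (Base \<rho>)"
      "q \<cdot> a = x \<cdot> d" using lift[OF \<sigma>hom(1)[OF xy(1)]] by blast
    have "x \<cdot> d = y \<cdot> d"
      using step[OF a(1), of "y \<cdot> d"] comp[OF xy(1) d(2)] comp[OF xy(2) d(2)] a(2) by simp
    then show ?thesis using is_regular_epi_epi[OF d \<sigma>hom[OF xy(1)]] by blast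
  qed
  \<comment> \<open>Reflexivity at the generic element of \<open>Q\<close>: precomposition with
    \<open>q\<close> turns it into the image of the generic element of \<open>A\<close>, where
    reflexivity of \<open>\<rho>\<close> is preserved.\<close>
  have "related C \<sigma> Q (Ide C Q) (Ide C Q)"
  proof (rule related_local[OF q \<sigma>(1)])
    show "Ide C Q \<in> hom C Q (Base \<sigma>)" using Ide_closed hom_Obj(2)[OF q(2)] \<sigma>(2) by simp
    then show "Ide C Q \<in> hom C Q (Base \<sigma>)" .
    show "related C \<sigma> (Base \<rho>) (Ide C Q \<cdot> q) (Ide C Q \<cdot> q)"
      using preserve[OF is_preorder_refl[OF pre Ide_closed[OF B]]] Ide_Comp[OF q(2)]
        Comp_Ide[OF q(2)] by simp
  qed
  then have "is_preorder C \<sigma>"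
    using \<sigma> is_transitiveI[OF \<sigma>(1) \<sigma>_trans]
    by (simp add: is_preorder_def is_reflexive_def rel_le_iff_related diag_rel_def)
  then have "is_partial_order C \<sigma>" using \<sigma>_antisym by (rule is_partial_orderI)
  then show ?thesis using q e ker \<sigma>(2) by blast
qed


section \<open>The category of internal preorders\<close>

lemma hom_PreOrd:
  "\<phi> \<in> hom (PreOrd C) \<rho> \<sigma> \<longleftrightarrow> is_preord_mor C \<phi> \<and> Src \<phi> = \<rho> \<and> Trg \<phi> = \<sigma>"
  by (auto simp: hom_def PreOrd_def)

lemma PreOrd_Map:
  "\<phi> \<in> hom (PreOrd C) \<rho> \<sigma> \<Longrightarrow> Map \<phi> \<in> hom C (Base \<rho>) (Base \<sigma>)"
  by (auto simp: hom_PreOrd is_preord_mor_def)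

lemma Map_Comp: "Map (\<psi> \<cdot>\<^bsub>PreOrd C\<^esub> \<phi>) = Map \<psi> \<cdot> Map \<phi>"
  by (simp add: PreOrd_def)

lemma PreOrd_operations:
  "Ide (PreOrd C) \<rho> = \<lparr>Src = \<rho>, Trg = \<rho>, Map = Ide C (Base \<rho>), Lift = Ide C (Tip \<rho>)\<rparr>"
  "\<psi> \<cdot>\<^bsub>PreOrd C\<^esub> \<phi> =
     \<lparr>Src = Src \<phi>, Trg = Trg \<psi>, Map = Map \<psi> \<cdot> Map \<phi>, Lift = Lift \<psi> \<cdot> Lift \<phi>\<rparr>"
  by (simp_all add: PreOrd_def)

lemma category_PreOrd: "category (PreOrd C)"
proof
  fix \<phi>
  show "\<phi> \<in> Arr (PreOrd C) \<Longrightarrow> Dom (PreOrd C) \<phi> \<in> Obj (PreOrd C)"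
    "\<phi> \<in> Arr (PreOrd C) \<Longrightarrow> Cod (PreOrd C) \<phi> \<in> Obj (PreOrd C)"
    by (auto simp: PreOrd_def is_preord_mor_def)
next
  fix \<rho> assume "\<rho> \<in> Obj (PreOrd C)"
  then have pre: "is_preorder C \<rho>" by (simp add: PreOrd_def)
  then have "is_relation C \<rho>" by (simp add: is_preorder_def)
  note legs = is_relation_legs[OF this]
  show "Ide (PreOrd C) \<rho> \<in> hom (PreOrd C) \<rho> \<rho>"
    unfolding hom_PreOrd using pre legs hom_Obj[OF legs(1)]
    by (auto simp: PreOrd_operations is_preord_mor_def Ide_closed Comp_Ide Ide_Comp)
next
  fix \<phi> \<psi> \<rho> \<sigma> \<tau>
  assume \<phi>: "\<phi> \<in> hom (PreOrd C) \<rho> \<sigma>" and \<psi>: "\<psi> \<in> hom (PreOrd C) \<sigma> \<tau>"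
  have rel: "is_relation C \<rho>" "is_relation C \<sigma>" "is_relation C \<tau>"
    using \<phi> \<psi> by (auto simp: hom_PreOrd is_preord_mor_def is_preorder_def)
  have f: "Map \<phi> \<in> hom C (Base \<rho>) (Base \<sigma>)" "Lift \<phi> \<in> hom C (Tip \<rho>) (Tip \<sigma>)"
    "Map \<phi> \<cdot> Leg1 \<rho> = Leg1 \<sigma> \<cdot> Lift \<phi>" "Map \<phi> \<cdot> Leg2 \<rho> = Leg2 \<sigma> \<cdot> Lift \<phi>"
    and g: "Map \<psi> \<in> hom C (Base \<sigma>) (Base \<tau>)" "Lift \<psi> \<in> hom C (Tip \<sigma>) (Tip \<tau>)"
    "Map \<psi> \<cdot> Leg1 \<sigma> = Leg1 \<tau> \<cdot> Lift \<psi>" "Map \<psi> \<cdot> Leg2 \<sigma> = Leg2 \<tau> \<cdot> Lift \<psi>"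
    using \<phi> \<psi> by (auto simp: hom_PreOrd is_preord_mor_def)
  have "(Map \<psi> \<cdot> Map \<phi>) \<cdot> Leg1 \<rho> = Leg1 \<tau> \<cdot> (Lift \<psi> \<cdot> Lift \<phi>)"
    using Comp_assoc[OF is_relation_legs(1)[OF rel(1)] f(1) g(1)]
      Comp_assoc[OF f(2) is_relation_legs(1)[OF rel(2)] g(1)]
      Comp_assoc[OF f(2) g(2) is_relation_legs(1)[OF rel(3)]] f(3) g(3) by simp
  moreover have "(Map \<psi> \<cdot> Map \<phi>) \<cdot> Leg2 \<rho> = Leg2 \<tau> \<cdot> (Lift \<psi> \<cdot> Lift \<phi>)"
    using Comp_assoc[OF is_relation_legs(2)[OF rel(1)] f(1) g(1)]
      Comp_assoc[OF f(2) is_relation_legs(2)[OF rel(2)] g(1)]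
      Comp_assoc[OF f(2) g(2) is_relation_legs(2)[OF rel(3)]] f(4) g(4) by simp
  ultimately show "\<psi> \<cdot>\<^bsub>PreOrd C\<^esub> \<phi> \<in> hom (PreOrd C) \<rho> \<tau>"
    using \<phi> \<psi> Comp_closed[OF f(1) g(1)] Comp_closed[OF f(2) g(2)]
    by (auto simp: hom_PreOrd PreOrd_operations is_preord_mor_def)
next
  fix \<phi> \<rho> \<sigma> assume "\<phi> \<in> hom (PreOrd C) \<rho> \<sigma>"
  then show "\<phi> \<cdot>\<^bsub>PreOrd C\<^esub> Ide (PreOrd C) \<rho> = \<phi>" "Ide (PreOrd C) \<sigma> \<cdot>\<^bsub>PreOrd C\<^esub> \<phi> = \<phi>"
    by (auto simp: hom_PreOrd is_preord_mor_def PreOrd_operations Comp_Ide Ide_Comp intro!: relmor.equality)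
next
  fix \<phi> \<psi> \<chi> \<rho> \<sigma> \<tau> \<upsilon>
  assume "\<phi> \<in> hom (PreOrd C) \<rho> \<sigma>" "\<psi> \<in> hom (PreOrd C) \<sigma> \<tau>" "\<chi> \<in> hom (PreOrd C) \<tau> \<upsilon>"
  then show "(\<chi> \<cdot>\<^bsub>PreOrd C\<^esub> \<psi>) \<cdot>\<^bsub>PreOrd C\<^esub> \<phi> = \<chi> \<cdot>\<^bsub>PreOrd C\<^esub> \<psi> \<cdot>\<^bsub>PreOrd C\<^esub> \<phi>"
    by (auto simp: hom_PreOrd is_preord_mor_def PreOrd_operations intro!: Comp_assoc)
qed

text \<open>The lift is determined by the underlying arrow, because the legs of the target relation
  are jointly monic. Equations between morphisms thus reduce to equations in
  \<open>C\<close>.\<close>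

lemma PreOrd_ext:
  assumes "\<phi> \<in> hom (PreOrd C) \<rho> \<sigma>" "\<psi> \<in> hom (PreOrd C) \<rho> \<sigma>" "Map \<phi> = Map \<psi>"
  shows "\<phi> = \<psi>"
proof -
  have "is_relation C \<sigma>" using assms by (auto simp: hom_PreOrd is_preord_mor_def is_preorder_def)
  then have "Lift \<phi> = Lift \<psi>"
    by (rule is_relation_jointly_monic) (use assms in \<open>auto simp: hom_PreOrd is_preord_mor_def\<close>)
  then show ?thesis using assms by (auto simp: hom_PreOrd intro: relmor.equality)
qed

lemma PreOrd_related:
  assumes \<phi>: "\<phi> \<in> hom (PreOrd C) \<rho> \<sigma>" and "related C \<rho> X a b"
  shows "related C \<sigma> X (Map \<phi> \<cdot> a) (Map \<phi> \<cdot> b)"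
proof -
  have rel: "is_relation C \<rho>" "is_relation C \<sigma>"
    and f: "Map \<phi> \<in> hom C (Base \<rho>) (Base \<sigma>)" "Lift \<phi> \<in> hom C (Tip \<rho>) (Tip \<sigma>)"
    "Map \<phi> \<cdot> Leg1 \<rho> = Leg1 \<sigma> \<cdot> Lift \<phi>" "Map \<phi> \<cdot> Leg2 \<rho> = Leg2 \<sigma> \<cdot> Lift \<phi>"
    using \<phi> by (auto simp: hom_PreOrd is_preord_mor_def is_preorder_def)
  obtain h where h: "h \<in> hom C X (Tip \<rho>)" "Leg1 \<rho> \<cdot> h = a" "Leg2 \<rho> \<cdot> h = b"
    using assms by (auto simp: related_def)
  have "Leg1 \<sigma> \<cdot> (Lift \<phi> \<cdot> h) = Map \<phi> \<cdot> a" "Leg2 \<sigma> \<cdot> (Lift \<phi> \<cdot> h) = Map \<phi> \<cdot> b"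
    using Comp_assoc[OF h(1) is_relation_legs(1)[OF rel(1)] f(1)]
      Comp_assoc[OF h(1) f(2) is_relation_legs(1)[OF rel(2)]]
      Comp_assoc[OF h(1) is_relation_legs(2)[OF rel(1)] f(1)]
      Comp_assoc[OF h(1) f(2) is_relation_legs(2)[OF rel(2)]] f(3,4) h(2,3) by auto
  then show ?thesis using Comp_closed[OF h(1) f(2)] by (auto simp: related_def)
qed

text \<open>A witness of the related pair is exactly a lift. It suffices to test monotonicity on the
  generic pair of the source.\<close>

lemma PreOrd_mor_exists:
  assumes "is_preorder C \<rho>" "is_preorder C \<sigma>" "f \<in> hom C (Base \<rho>) (Base \<sigma>)"
    and "related C \<sigma> (Tip \<rho>) (f \<cdot> Leg1 \<rho>) (f \<cdot> Leg2 \<rho>)"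
  shows "\<exists>\<phi> \<in> hom (PreOrd C) \<rho> \<sigma>. Map \<phi> = f"
proof -
  obtain h where "h \<in> hom C (Tip \<rho>) (Tip \<sigma>)" "Leg1 \<sigma> \<cdot> h = f \<cdot> Leg1 \<rho>" "Leg2 \<sigma> \<cdot> h = f \<cdot> Leg2 \<rho>"
    using assms by (auto simp: related_def)
  then have "\<lparr>Src = \<rho>, Trg = \<sigma>, Map = f, Lift = h\<rparr> \<in> hom (PreOrd C) \<rho> \<sigma>"
    using assms by (auto simp: hom_PreOrd is_preord_mor_def)
  then show ?thesis by force
qed

text \<open>The kernel condition gives a factorization \<open>k\<close> of the underlying arrows. It
  is monotone because the generic pair of \<open>\<sigma>\<close> may be tested after precomposition
  with \<open>Lift \<phi>\<close>, and it is unique because \<open>Map \<phi>\<close> is epic. It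
  yields both the coequalizer property of \<open>\<phi>\<close> and the universal property of the
  reflection.\<close>

lemma PreOrd_factor:
  assumes \<phi>: "\<phi> \<in> hom (PreOrd C) \<rho> \<sigma>" "is_regular_epi C (Map \<phi>)" "is_regular_epi C (Lift \<phi>)"
    and \<psi>: "\<psi> \<in> hom (PreOrd C) \<rho> \<tau>"
    and ker: "\<And>X u v. u \<in> hom C X (Base \<rho>) \<Longrightarrow> v \<in> hom C X (Base \<rho>) \<Longrightarrow>
      Map \<phi> \<cdot> u = Map \<phi> \<cdot> v \<Longrightarrow> Map \<psi> \<cdot> u = Map \<psi> \<cdot> v"
  shows "\<exists>!\<chi>. \<chi> \<in> hom (PreOrd C) \<sigma> \<tau> \<and> \<chi> \<cdot>\<^bsub>PreOrd C\<^esub> \<phi> = \<psi>"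
proof -
  interpret PO: category "PreOrd C" by (rule category_PreOrd)
  have pre: "is_preorder C \<sigma>" "is_preorder C \<tau>" and rel: "is_relation C \<rho>" "is_relation C \<sigma>" "is_relation C \<tau>"
    and e: "Lift \<phi> \<in> hom C (Tip \<rho>) (Tip \<sigma>)"
      "Map \<phi> \<cdot> Leg1 \<rho> = Leg1 \<sigma> \<cdot> Lift \<phi>" "Map \<phi> \<cdot> Leg2 \<rho> = Leg2 \<sigma> \<cdot> Lift \<phi>"
    using \<phi> \<psi> by (auto simp: hom_PreOrd is_preord_mor_def is_preorder_def)
  note q = PreOrd_Map[OF \<phi>(1)] and legs = is_relation_legs[OF rel(1)]
    and \<sigma>legs = is_relation_legs[OF rel(2)]
  obtain k where k: "k \<in> hom C (Base \<sigma>) (Base \<tau>)" "k \<cdot> Map \<phi> = Map \<psi>"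
    using is_regular_epi_factor[OF \<phi>(2) q PreOrd_Map[OF \<psi>]] ker by blast
  have "related C \<tau> (Tip \<sigma>) (k \<cdot> Leg1 \<sigma>) (k \<cdot> Leg2 \<sigma>)"
  proof (rule related_local[OF \<phi>(3) e(1) rel(3)])
    show "k \<cdot> Leg1 \<sigma> \<in> hom C (Tip \<sigma>) (Base \<tau>)" "k \<cdot> Leg2 \<sigma> \<in> hom C (Tip \<sigma>) (Base \<tau>)"
      using Comp_closed \<sigma>legs k(1) by blast+
    show "related C \<tau> (Tip \<rho>) ((k \<cdot> Leg1 \<sigma>) \<cdot> Lift \<phi>) ((k \<cdot> Leg2 \<sigma>) \<cdot> Lift \<phi>)"
      using PreOrd_related[OF \<psi> related_tip[OF rel(1)]]
        Comp_assoc[OF e(1) \<sigma>legs(1) k(1)] Comp_assoc[OF e(1) \<sigma>legs(2) k(1)]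
        Comp_assoc[OF legs(1) q k(1)] Comp_assoc[OF legs(2) q k(1)] e(2,3) k(2) by simp
  qed
  then obtain \<chi> where \<chi>: "\<chi> \<in> hom (PreOrd C) \<sigma> \<tau>" "Map \<chi> = k"
    using PreOrd_mor_exists pre k(1) by blast
  show ?thesis
  proof (rule ex1I[of _ \<chi>], intro conjI)
    show "\<chi> \<cdot>\<^bsub>PreOrd C\<^esub> \<phi> = \<psi>"
      using PreOrd_ext[OF PO.Comp_closed[OF \<phi>(1) \<chi>(1)] \<psi>] \<chi>(2) k(2) by (simp add: Map_Comp)
  next
    fix \<chi>' assume \<chi>': "\<chi>' \<in> hom (PreOrd C) \<sigma> \<tau> \<and> \<chi>' \<cdot>\<^bsub>PreOrd C\<^esub> \<phi> = \<psi>"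
    then have "Map \<chi>' \<cdot> Map \<phi> = k \<cdot> Map \<phi>" using k(2) Map_Comp by metis
    then have "Map \<chi>' = k"
      using is_regular_epi_epi[OF \<phi>(2) q] PreOrd_Map \<chi>' k(1) by blast
    then show "\<chi>' = \<chi>" using PreOrd_ext \<chi> \<chi>' by blast
  qed (rule \<chi>(1))
qed

text \<open>
  The coequalized pair is the kernel pair of \<open>Map \<phi>\<close> with the discrete order on its domain.
\<close>

lemma PreOrd_regular_epi:
  assumes \<phi>: "\<phi> \<in> hom (PreOrd C) \<rho> \<sigma>" "is_regular_epi C (Map \<phi>)" "is_regular_epi C (Lift \<phi>)"
  shows "is_regular_epi (PreOrd C) \<phi>"
proof -
  interpret PO: category "PreOrd C" by (rule category_PreOrd)
  note q = PreOrd_Map[OF \<phi>(1)]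
  have pre: "is_preorder C \<rho>" using \<phi>(1) by (auto simp: hom_PreOrd is_preord_mor_def)
  obtain M u v where M: "is_pullback C (Map \<phi>) (Map \<phi>) M u v" using pullback_exists[OF q q] by blast
  then have uv: "u \<in> hom C M (Base \<rho>)" "v \<in> hom C M (Base \<rho>)" "Map \<phi> \<cdot> u = Map \<phi> \<cdot> v"
    using q by (auto simp: is_pullback_def hom_def)
  let ?M = "diag_rel C M"
  have "is_preorder C ?M" using is_preorder_diag hom_Obj[OF uv(1)] by blast
  \<comment> \<open>Any arrow out of a discrete preorder is monotone, by reflexivity of the
    target.\<close>
  have discrete: "\<exists>\<alpha> \<in> hom (PreOrd C) ?M \<rho>. Map \<alpha> = w" if w: "w \<in> hom C M (Base \<rho>)" for w
    using w is_preorder_refl[OF pre w] Comp_Ide[OF w]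
    by (intro PreOrd_mor_exists[OF \<open>is_preorder C ?M\<close> pre]) (simp_all add: diag_rel_def)
  obtain \<alpha> where \<alpha>: "\<alpha> \<in> hom (PreOrd C) ?M \<rho>" "Map \<alpha> = u" using discrete uv by blast
  obtain \<beta> where \<beta>: "\<beta> \<in> hom (PreOrd C) ?M \<rho>" "Map \<beta> = v" using discrete uv by blast
  have eq: "\<phi> \<cdot>\<^bsub>PreOrd C\<^esub> \<alpha> = \<phi> \<cdot>\<^bsub>PreOrd C\<^esub> \<beta>"
    using PreOrd_ext[OF PO.Comp_closed[OF \<alpha>(1) \<phi>(1)] PO.Comp_closed[OF \<beta>(1) \<phi>(1)]] \<alpha>(2) \<beta>(2) uv(3)
    by (simp add: Map_Comp)
  have "\<exists>!\<chi>. \<chi> \<in> hom (PreOrd C) \<sigma> \<tau> \<and> \<chi> \<cdot>\<^bsub>PreOrd C\<^esub> \<phi> = \<psi>"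
    if \<psi>: "\<psi> \<in> hom (PreOrd C) \<rho> \<tau>" "\<psi> \<cdot>\<^bsub>PreOrd C\<^esub> \<alpha> = \<psi> \<cdot>\<^bsub>PreOrd C\<^esub> \<beta>" for \<psi> \<tau>
  proof (rule PreOrd_factor[OF \<phi> \<psi>(1)])
    fix X a b assume ab: "a \<in> hom C X (Base \<rho>)" "b \<in> hom C X (Base \<rho>)" "Map \<phi> \<cdot> a = Map \<phi> \<cdot> b"
    have "Dom C (Map \<phi>) = Base \<rho>" using q by (simp add: hom_def)
    \<comment> \<open>Any two elements identified by \<open>Map \<phi>\<close> come from the kernel
      pair, so equality on \<open>u\<close> and \<open>v\<close> implies equality on them.\<close>
    then obtain w where w: "w \<in> hom C X M" "u \<cdot> w = a" "v \<cdot> w = b"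
      using M ab unfolding is_pullback_def by metis
    have "Map \<psi> \<cdot> u = Map \<psi> \<cdot> v" using \<psi>(2) \<alpha>(2) \<beta>(2) Map_Comp by metis
    then show "Map \<psi> \<cdot> a = Map \<psi> \<cdot> b"
      using Comp_assoc[OF w(1) uv(1) PreOrd_Map[OF \<psi>(1)]]
        Comp_assoc[OF w(1) uv(2) PreOrd_Map[OF \<psi>(1)]] w(2,3) by simp
  qed
  then have "is_coequalizer (PreOrd C) \<alpha> \<beta> \<phi>"
    using \<alpha>(1) \<beta>(1) \<phi>(1) eq by (auto simp: is_coequalizer_def hom_def)
  then show ?thesis by (auto simp: is_regular_epi_def)
qed

text \<open>Elements identified by \<open>q\<close> are related both ways by \<open>\<rho>\<close>;
  a morphism \<open>\<psi>\<close> preserves this, and antisymmetry of the target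
  \<open>\<tau>\<close> makes their images equal. This is the kernel condition of
  \<open>PreOrd_factor\<close>.\<close>

lemma partial_order_reflection:
  assumes \<rho>: "\<rho> \<in> Obj (PreOrd C)"
  shows "\<exists>\<sigma> \<phi>. is_partial_order C \<sigma> \<and> \<phi> \<in> hom (PreOrd C) \<rho> \<sigma> \<and> is_regular_epi (PreOrd C) \<phi> \<and>
    (\<forall>\<tau> \<psi>. is_partial_order C \<tau> \<longrightarrow> \<psi> \<in> hom (PreOrd C) \<rho> \<tau> \<longrightarrow>
      (\<exists>!\<chi>. \<chi> \<in> hom (PreOrd C) \<sigma> \<tau> \<and> \<chi> \<cdot>\<^bsub>PreOrd C\<^esub> \<phi> = \<psi>))"
proof -
  have pre: "is_preorder C \<rho>" using \<rho> by (simp add: PreOrd_def)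
  obtain \<sigma> q e where \<sigma>: "is_partial_order C \<sigma>"
    and q: "is_regular_epi C q" "q \<in> hom C (Base \<rho>) (Base \<sigma>)"
    and e: "is_regular_epi C e" "e \<in> hom C (Tip \<rho>) (Tip \<sigma>)"
      "Leg1 \<sigma> \<cdot> e = q \<cdot> Leg1 \<rho>" "Leg2 \<sigma> \<cdot> e = q \<cdot> Leg2 \<rho>"
    and ker: "\<And>X a b. a \<in> hom C X (Base \<rho>) \<Longrightarrow> b \<in> hom C X (Base \<rho>) \<Longrightarrow>
       q \<cdot> a = q \<cdot> b \<Longrightarrow> related C \<rho> X a b \<and> related C \<rho> X b a"
    using partial_order_quotient[OF pre] by blast
  define \<phi> where "\<phi> = \<lparr>Src = \<rho>, Trg = \<sigma>, Map = q, Lift = e\<rparr>"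
  have \<phi>: "\<phi> \<in> hom (PreOrd C) \<rho> \<sigma>" "is_regular_epi C (Map \<phi>)" "is_regular_epi C (Lift \<phi>)"
    using pre \<sigma> q e by (auto simp: \<phi>_def hom_PreOrd is_preord_mor_def is_partial_order_def)
  have "\<exists>!\<chi>. \<chi> \<in> hom (PreOrd C) \<sigma> \<tau> \<and> \<chi> \<cdot>\<^bsub>PreOrd C\<^esub> \<phi> = \<psi>"
    if \<tau>: "is_partial_order C \<tau>" and \<psi>: "\<psi> \<in> hom (PreOrd C) \<rho> \<tau>" for \<tau> \<psi>
  proof (rule PreOrd_factor[OF \<phi> \<psi>])
    fix X a b assume "a \<in> hom C X (Base \<rho>)" "b \<in> hom C X (Base \<rho>)" "Map \<phi> \<cdot> a = Map \<phi> \<cdot> b"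
    then have "related C \<rho> X a b" "related C \<rho> X b a" using ker by (auto simp: \<phi>_def)
    then show "Map \<psi> \<cdot> a = Map \<psi> \<cdot> b"
      by (intro is_partial_order_antisym[OF \<tau>] PreOrd_related[OF \<psi>])
  qed
  then show ?thesis using \<sigma> \<phi>(1) PreOrd_regular_epi[OF \<phi>] by blast
qed

end

section \<open>Existence of the adjunction and regularity of every unit\<close>

theorem corollary1p4:
  fixes C :: "('o, 'm) cat"
  assumes "exact_category C"
  shows "(\<exists>F \<eta> \<epsilon>. is_adjunction (PreOrd C) (ParOrd C) F ParOrd_incl \<eta> \<epsilon>)
    \<and> (\<forall>F \<eta> \<epsilon>. is_adjunction (PreOrd C) (ParOrd C) F ParOrd_incl \<eta> \<epsilon> \<longrightarrow>
         (\<forall>\<rho> \<in> Obj (PreOrd C). is_regular_epi (PreOrd C) (\<eta> \<rho>)))"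
proof -
  interpret exact_category C by fact
  have incl: "ParOrd_incl = id_functor" by (simp add: ParOrd_incl_def id_functor_def)
  define reflects where "reflects \<rho> \<sigma> \<phi> \<longleftrightarrow>
    is_partial_order C \<sigma> \<and> \<phi> \<in> hom (PreOrd C) \<rho> \<sigma> \<and> is_regular_epi (PreOrd C) \<phi> \<and>
    (\<forall>\<tau> \<psi>. is_partial_order C \<tau> \<longrightarrow> \<psi> \<in> hom (PreOrd C) \<rho> \<tau> \<longrightarrow>
      (\<exists>!\<chi>. \<chi> \<in> hom (PreOrd C) \<sigma> \<tau> \<and> \<chi> \<cdot>\<^bsub>PreOrd C\<^esub> \<phi> = \<psi>))" for \<rho> \<sigma> \<phi>
  have "\<forall>\<rho> \<in> Obj (PreOrd C). \<exists>\<sigma>. \<exists>\<phi>. reflects \<rho> \<sigma> \<phi>"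
    unfolding reflects_def using partial_order_reflection by blast
  \<comment> \<open>Choice is used twice, for the reflected objects and then for the reflecting
    arrows, to obtain them as functions of \<open>\<rho>\<close>.\<close>
  from bchoice[OF this] obtain R where "\<forall>\<rho> \<in> Obj (PreOrd C). \<exists>\<phi>. reflects \<rho> (R \<rho>) \<phi>" ..
  from bchoice[OF this] obtain q where reflects: "\<forall>\<rho> \<in> Obj (PreOrd C). reflects \<rho> (R \<rho>) (q \<rho>)" ..
  then have R: "is_partial_order C (R \<rho>)"
    and q: "q \<rho> \<in> hom (PreOrd C) \<rho> (R \<rho>)"
    and reg: "is_regular_epi (PreOrd C) (q \<rho>)"
    and univ: "is_partial_order C \<tau> \<Longrightarrow> \<psi> \<in> hom (PreOrd C) \<rho> \<tau> \<Longrightarrow>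
      \<exists>!\<chi>. \<chi> \<in> hom (PreOrd C) (R \<rho>) \<tau> \<and> \<chi> \<cdot>\<^bsub>PreOrd C\<^esub> q \<rho> = \<psi>"
    if "\<rho> \<in> Obj (PreOrd C)" for \<rho> \<tau> \<psi>
    using that unfolding reflects_def by blast+
  have "\<exists>F \<epsilon>. is_adjunction (PreOrd C) (ParOrd C) F ParOrd_incl q \<epsilon>"
    unfolding incl ParOrd_def using category_PreOrd R q univ
    by (rule universal_arrows_imp_adjunction)
  moreover have "is_regular_epi (PreOrd C) (\<eta> \<rho>)"
    if adj: "is_adjunction (PreOrd C) (ParOrd C) F ParOrd_incl \<eta> \<epsilon>" and \<rho>: "\<rho> \<in> Obj (PreOrd C)"
    for F \<eta> \<epsilon> \<rho>
  proof -
    \<comment> \<open>The unit of the given adjunction and \<open>q \<rho>\<close> are universal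
      against the same partial orders, so the pair coequalized by \<open>q \<rho>\<close> is
      coequalized by that unit as well.\<close>
    note unit = adjunction_imp_universal_arrows[OF adj[unfolded incl ParOrd_def] \<rho>]
    obtain f g where "is_coequalizer (PreOrd C) f g (q \<rho>)"
      using reg[OF \<rho>] by (auto simp: is_regular_epi_def)
    then have "is_coequalizer (PreOrd C) f g (\<eta> \<rho>)"
      using universal_arrow_coequalizer[OF category_PreOrd _ q[OF \<rho>] R[OF \<rho>] univ[OF \<rho>] unit(2,1,3)]
      by blast
    then show ?thesis by (auto simp: is_regular_epi_def)
  qed
  ultimately show ?thesis by blast
qed

end
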